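(* Let $H$ be a complex Hilbert space with $\dim H\geq 2$ and let $\phi:E(H)\to E(H)$ be a sequential automorphism. Then $\phi$ preserves the order and zero product in both directions, i.e., for all $A,B\in E(H)$, $A\leq B\Longleftrightarrow\phi(A)\leq\phi(B)$ and $AB=0\Longleftrightarrow\phi(A)\phi(B)=0$. In fact, there is an either unitary or antiunitary operator $U$ on $H$ such that \[ \phi(A)=UAU^*\qquad (A\in E(H)). \]
   Context: $E(H)$ denotes the set of all (Hilbert space) effects on $H$, i.e., all positive bounded linear operators $A$ on $H$ with $0\leq A\leq I$, where $I$ is the identity. The order $\leq$ is the usual order among self-adjoint bounded linear operators. The sequential product of $A,B\in E(H)$ is $A\circ B=\sqrt{A}\,B\sqrt{A}$. A bijective map $\phi:E(H)\to E(H)$ is called a sequential automorphism if $\phi(A\circ B)=\phi(A)\circ\phi(B)$ holds for every $A,B\in E(H)$. *)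

theory Defs
  imports "HOL-Analysis.Analysis"
begin

section \<open>Complex Hilbert spaces\<close>

text \<open>A complex inner product space is presented as a real inner product space together with
  a compatible complex structure: the real inner product is the real part of the complex one,
  so both induce the same norm. The complex inner product is linear in its first argument.
  The remaining usual axioms are derived below.\<close>

class complex_inner = real_inner +
  fixes scaleC :: "complex \<Rightarrow> 'a \<Rightarrow> 'a" (infixr "*\<^sub>C" 75)
    and cinner :: "'a \<Rightarrow> 'a \<Rightarrow> complex"
  assumes scaleC_add_right: "c *\<^sub>C (x + y) = c *\<^sub>C x + c *\<^sub>C y"
    and scaleC_add_left: "(c + d) *\<^sub>C x = c *\<^sub>C x + d *\<^sub>C x"
    and scaleC_scaleC: "c *\<^sub>C d *\<^sub>C x = (c * d) *\<^sub>C x"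
    and scaleR_scaleC: "r *\<^sub>R x = complex_of_real r *\<^sub>C x"
    and cinner_commute: "cinner x y = cnj (cinner y x)"
    and cinner_add_left: "cinner (x + y) z = cinner x z + cinner y z"
    and cinner_scaleC_left: "cinner (c *\<^sub>C x) y = c * cinner x y"
    and Re_cinner: "Re (cinner x y) = inner x y"

class complex_hilbert_space = complex_inner + complete_space

lemma cinner_self: "cinner x x = complex_of_real ((norm x)\<^sup>2)"
  for x :: "'a::complex_inner"
proof (rule complex_eqI)
  show "Re (cinner x x) = Re (complex_of_real ((norm x)\<^sup>2))"
    by (simp add: Re_cinner power2_norm_eq_inner)
  show "Im (cinner x x) = Im (complex_of_real ((norm x)\<^sup>2))"
    using arg_cong[OF cinner_commute[of x x], of Im] by simp
qed

lemma cinner_scaleC_right: "cinner x (c *\<^sub>C y) = cnj c * cinner x y"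
  for x y :: "'a::complex_inner"
  by (metis cinner_commute cinner_scaleC_left complex_cnj_mult)

lemma Im_cinner: "Im (cinner x y) = inner x (\<i> *\<^sub>C y)"
  for x y :: "'a::complex_inner"
  by (simp add: cinner_scaleC_right flip: Re_cinner)

global_interpretation complex_vector: vector_space
  "scaleC :: complex \<Rightarrow> 'a \<Rightarrow> 'a::complex_inner"
  by unfold_locales
    (simp_all add: scaleC_add_right scaleC_add_left scaleC_scaleC
      scaleR_scaleC[of 1, simplified, symmetric])


section \<open>Operators\<close>

text \<open>The type \<open>'a \<Rightarrow>\<^sub>L 'a\<close> consists of the bounded real-linear operators;
  complex linearity is imposed separately.\<close>

abbreviation clinear :: "('a::complex_inner \<Rightarrow> 'a) \<Rightarrow> bool" where
  "clinear \<equiv> Vector_Spaces.linear scaleC scaleC"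

definition antilinear :: "('a::complex_inner \<Rightarrow> 'a) \<Rightarrow> bool" where
  "antilinear f \<longleftrightarrow> (\<forall>x y. f (x + y) = f x + f y) \<and> (\<forall>c x. f (c *\<^sub>C x) = cnj c *\<^sub>C f x)"

definition unitary :: "('a::complex_inner \<Rightarrow> 'a) \<Rightarrow> bool" where
  "unitary U \<longleftrightarrow> clinear U \<and> surj U \<and> (\<forall>x y. cinner (U x) (U y) = cinner x y)"

definition antiunitary :: "('a::complex_inner \<Rightarrow> 'a) \<Rightarrow> bool" where
  "antiunitary U \<longleftrightarrow> antilinear U \<and> surj U \<and> (\<forall>x y. cinner (U x) (U y) = cnj (cinner x y))"

text \<open>The library constant \<^const>\<open>adjoint\<close> refers to the real inner product. For unitary and
  antiunitary operators it is the usual adjoint with respect to the complex inner product.\<close>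

lemma adjoint_eqI:
  fixes U V :: "'a::complex_inner \<Rightarrow> 'a"
  assumes "(\<forall>x y. cinner (U x) y = cinner x (V y)) \<or> (\<forall>x y. cinner (U x) y = cnj (cinner x (V y)))"
  shows "adjoint U = V"
  using assms by (intro adjoint_unique) (auto simp flip: Re_cinner)

lemma cinner_adjoint_unitary:
  assumes "unitary U"
  shows "cinner (U x) y = cinner x (adjoint U y)"
proof -
  have *: "cinner (U x) y = cinner x (inv U y)" for x y
    using assms unfolding unitary_def by (metis surj_f_inv_f)
  then have "adjoint U = inv U"
    by (intro adjoint_eqI) blast
  then show ?thesis
    using * by simp
qed

lemma cinner_adjoint_antiunitary:
  assumes "antiunitary U"
  shows "cinner (U x) y = cnj (cinner x (adjoint U y))"
proof -
  have *: "cinner (U x) y = cnj (cinner x (inv U y))" for x y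
    using assms unfolding antiunitary_def by (metis surj_f_inv_f)
  then have "adjoint U = inv U"
    by (intro adjoint_eqI) blast
  then show ?thesis
    using * by simp
qed

definition selfadjoint :: "('a::complex_inner \<Rightarrow>\<^sub>L 'a) \<Rightarrow> bool" where
  "selfadjoint A \<longleftrightarrow> clinear A \<and> (\<forall>x y. cinner (A x) y = cinner x (A y))"

definition op_le :: "('a::complex_inner \<Rightarrow>\<^sub>L 'a) \<Rightarrow> ('a \<Rightarrow>\<^sub>L 'a) \<Rightarrow> bool" (infix "\<preceq>" 50) where
  "A \<preceq> B \<longleftrightarrow> selfadjoint A \<and> selfadjoint B \<and> (\<forall>x. Re (cinner (A x) x) \<le> Re (cinner (B x) x))"

definition effects :: "('a::complex_inner \<Rightarrow>\<^sub>L 'a) set" where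
  "effects = {A. 0 \<preceq> A \<and> A \<preceq> id_blinfun}"

text \<open>The positive square root exists and is unique for positive operators on a complete space;
  for other operators the value is irrelevant.\<close>

definition sqrt_op :: "('a::complex_hilbert_space \<Rightarrow>\<^sub>L 'a) \<Rightarrow> ('a \<Rightarrow>\<^sub>L 'a)" where
  "sqrt_op A = (THE R. 0 \<preceq> R \<and> R o\<^sub>L R = A)"

definition seq_prod :: "('a::complex_hilbert_space \<Rightarrow>\<^sub>L 'a) \<Rightarrow> ('a \<Rightarrow>\<^sub>L 'a) \<Rightarrow> ('a \<Rightarrow>\<^sub>L 'a)"
    (infixl "\<circ>\<^sub>s" 70) where
  "A \<circ>\<^sub>s B = sqrt_op A o\<^sub>L B o\<^sub>L sqrt_op A"

definition sequential_automorphism ::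
    "(('a::complex_hilbert_space \<Rightarrow>\<^sub>L 'a) \<Rightarrow> ('a \<Rightarrow>\<^sub>L 'a)) \<Rightarrow> bool" where
  "sequential_automorphism \<phi> \<longleftrightarrow>
     bij_betw \<phi> effects effects \<and>
     (\<forall>A\<in>effects. \<forall>B\<in>effects. \<phi> (A \<circ>\<^sub>s B) = \<phi> A \<circ>\<^sub>s \<phi> B)"

end

theory Submission
  imports Defs
begin

text \<open>
  The sequential product determines the Jordan triple product: since \<open>A \<circ>\<^sub>s A = A\<^sup>2\<close> and
  \<open>A\<^sup>2 \<circ>\<^sub>s B = A B A\<close>, a sequential automorphism \<open>\<phi>\<close> satisfies \<open>\<phi>(A\<^sup>2) = \<phi>(A)\<^sup>2\<close> and
  \<open>\<phi>(A B A) = \<phi>(A) \<phi>(B) \<phi>(A)\<close>. Existence and uniqueness of the positive square root of an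
  effect enter here and nowhere else (\<open>effect_has_root\<close>, \<open>sqrt_op_square\<close>). As \<open>A B A = 0\<close>
  exactly if \<open>B A = 0\<close>, zero products are preserved in both directions.

  The triple product controls projections: \<open>Q\<close> lies below \<open>P\<close> iff \<open>P Q P = Q\<close>. So \<open>\<phi>\<close>
  permutes the projections and the minimal ones among them, which are the rank-one projections,
  and it commutes with \<open>P \<mapsto> I - P\<close>, because \<open>I - P\<close> is the largest projection with zero product
  with \<open>P\<close>. Let \<open>x\<close> be a unit vector, \<open>P\<^sub>x\<close> the projection onto its line and \<open>\<phi>(P\<^sub>x) = P\<^sub>y\<close>.
  From \<open>P\<^sub>x A P\<^sub>x = \<langle>A x, x\<rangle> P\<^sub>x\<close> one gets a function \<open>f\<close> on the unit interval, given by
  \<open>\<phi>(t P\<^sub>x) = f(t) P\<^sub>y\<close>, such that \<open>\<langle>\<phi>(A) y, y\<rangle> = f(\<langle>A x, x\<rangle>)\<close> for all effects \<open>A\<close>. It is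
  multiplicative. In dimension at least two, every \<open>t\<close> between 0 and 1 is \<open>\<langle>P\<^sub>z x, x\<rangle>\<close> for some
  unit vector \<open>z\<close>, and complements then give \<open>f(1 - t) = 1 - f(t)\<close>. These two properties make
  \<open>f\<close> additive, hence \<open>f(t) = t\<close> (\<open>multiplicative_symmetric_eq_id\<close>), and
  \<open>\<langle>\<phi>(A) y, y\<rangle> = \<langle>A x, x\<rangle>\<close> (\<open>expectation_preserved\<close>).

  With rank-one \<open>A\<close> this says that the bijection of lines induced by \<open>\<phi>\<close> preserves transition
  probabilities, so by Wigner's theorem (\<open>wigner\<close>) it comes from a unitary or antiunitary \<open>U\<close>.
  Consequently \<open>\<langle>\<phi>(A) U x, U x\<rangle> = \<langle>A x, x\<rangle>\<close> for all \<open>x\<close>, which yields the order statement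
  directly and \<open>\<phi>(A) = U A U\<^sup>*\<close> by polarization.
\<close>

section \<open>Complex inner products\<close>

lemma cinner_add_right: "cinner x (y + z) = cinner x y + cinner x z"
  for x y z :: "'a::complex_inner"
  by (metis cinner_add_left cinner_commute complex_cnj_add)

lemma cinner_zero_left [simp]: "cinner 0 (x :: 'a::complex_inner) = 0"
  using cinner_add_left[of 0 0 x] by simp

lemma cinner_zero_right [simp]: "cinner (x :: 'a::complex_inner) 0 = 0"
  using cinner_add_right[of x 0 0] by simp

lemma cinner_diff_left: "cinner (x - y) z = cinner x z - cinner y z"
  for x y z :: "'a::complex_inner"
  using cinner_add_left[of "x - y" y z] by simp

lemma cinner_diff_right: "cinner x (y - z) = cinner x y - cinner x z"
  for x y z :: "'a::complex_inner"
  using cinner_add_right[of x "y - z" z] by simp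

lemma cinner_scaleR_left: "cinner (r *\<^sub>R x) y = complex_of_real r * cinner x y"
  for x y :: "'a::complex_inner"
  by (simp add: scaleR_scaleC cinner_scaleC_left)

lemma cinner_scaleR_right: "cinner x (r *\<^sub>R y) = complex_of_real r * cinner x y"
  for x y :: "'a::complex_inner"
  by (simp add: scaleR_scaleC cinner_scaleC_right)

lemmas cinner_simps = cinner_add_left cinner_add_right cinner_diff_left cinner_diff_right
  cinner_scaleC_left cinner_scaleC_right cinner_scaleR_left cinner_scaleR_right

lemma cinner_eqI: "x = y" if "\<And>z. cinner x z = cinner y z"
  for x y :: "'a::complex_inner"
proof -
  have "cinner (x - y) (x - y) = 0"
    by (simp add: cinner_diff_left that)
  then show ?thesis
    by (simp add: cinner_self)
qed

lemma cinner_eq_0_commute: "cinner x y = 0 \<longleftrightarrow> cinner y x = 0"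
  for x y :: "'a::complex_inner"
  by (metis cinner_commute complex_cnj_zero)

lemma norm_scaleC: "norm (c *\<^sub>C x) = cmod c * norm x" for x :: "'a::complex_inner"
proof -
  have "complex_of_real ((norm (c *\<^sub>C x))\<^sup>2) = c * cnj c * cinner x x"
    by (simp only: cinner_self[symmetric] cinner_simps) (simp only: mult_ac)
  also have "\<dots> = complex_of_real ((cmod c * norm x)\<^sup>2)"
    by (simp only: cinner_self complex_norm_square[symmetric] power_mult_distrib of_real_mult of_real_power)
  finally show ?thesis
    by (simp only: of_real_eq_iff) (simp add: power2_eq_iff_nonneg)
qed

lemma cmod_cinner_self: "cmod (cinner x x) = (norm x)\<^sup>2" for x :: "'a::complex_inner"
  by (simp only: cinner_self norm_of_real) simp

text \<open>Pythagoras for the orthogonal projection onto the line of \<open>y\<close>; it gives the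
  Cauchy--Schwarz inequality for the complex inner product together with its equality case.\<close>

lemma norm_diff_proj:
  fixes x y :: "'a::complex_inner"
  assumes "norm y = 1"
  shows "(norm (x - cinner x y *\<^sub>C y))\<^sup>2 = (norm x)\<^sup>2 - (cmod (cinner x y))\<^sup>2"
proof -
  define a where "a = cinner x y"
  have ip: "cinner y y = 1" "cinner y x = cnj a" "cinner x y = a"
    using assms cinner_commute[of y x] by (simp_all add: cinner_self a_def)
  have "complex_of_real ((norm (x - a *\<^sub>C y))\<^sup>2) = cinner x x - a * cnj a"
    by (simp add: cinner_self[symmetric] cinner_simps ip algebra_simps del: of_real_power)
  also have "\<dots> = complex_of_real ((norm x)\<^sup>2 - (cmod a)\<^sup>2)"
    by (simp only: cinner_self complex_norm_square[symmetric] of_real_diff of_real_power)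
  finally show ?thesis
    by (simp only: of_real_eq_iff a_def)
qed

lemma cmod_cinner_le: "cmod (cinner x y) \<le> norm x * norm y" for x y :: "'a::complex_inner"
proof (cases "y = 0")
  case False
  define u where "u = (1 / norm y) *\<^sub>R y"
  have u: "norm u = 1" "y = norm y *\<^sub>R u"
    using False by (auto simp: u_def)
  have "(cmod (cinner x u))\<^sup>2 \<le> (norm x)\<^sup>2"
    using norm_diff_proj[OF u(1), of x] zero_le_power2[of "norm (x - cinner x u *\<^sub>C u)"] by linarith
  then have "cmod (cinner x u) \<le> norm x"
    by simp
  moreover have "cmod (cinner x y) = cmod (cinner x u) * norm y"
    by (subst u(2)) (simp add: cinner_simps norm_mult mult.commute)
  ultimately show ?thesis
    by (simp add: mult_right_mono)
qed simp

lemma cauchy_schwarz_equality: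
  fixes x y :: "'a::complex_inner"
  assumes "y \<noteq> 0" and "cmod (cinner x y) = norm x * norm y"
  shows "\<exists>c. x = c *\<^sub>C y"
proof -
  define u where "u = (1 / norm y) *\<^sub>R y"
  have u: "norm u = 1"
    using assms by (auto simp: u_def)
  have "cmod (cinner x u) = norm x"
    using assms by (simp add: u_def cinner_simps norm_mult norm_divide)
  then have "x = cinner x u *\<^sub>C u"
    using norm_diff_proj[OF u, of x] by simp
  also have "\<dots> = (cinner x u * complex_of_real (1 / norm y)) *\<^sub>C y"
    unfolding u_def by (simp only: scaleR_scaleC scaleC_scaleC)
  finally show ?thesis by blast
qed

lemma unit_multiple_if_norm_eq:
  fixes x y :: "'a::complex_inner"
  assumes "x = c *\<^sub>C y" and "norm x = norm y"
  shows "\<exists>c. cmod c = 1 \<and> x = c *\<^sub>C y"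
proof (cases "y = 0")
  case True
  then show ?thesis
    using assms by (intro exI[of _ 1]) simp
next
  case False
  then have "cmod c = 1"
    using assms by (simp add: norm_scaleC)
  then show ?thesis using assms(1) by blast
qed

lemma cauchy_schwarz_equality_unit:
  fixes x y :: "'a::complex_inner"
  assumes "norm x = norm y" and "cmod (cinner x y) = norm x * norm y"
  shows "\<exists>c. cmod c = 1 \<and> x = c *\<^sub>C y"
proof (cases "y = 0")
  case False
  then show ?thesis
    using cauchy_schwarz_equality[OF False assms(2)] unit_multiple_if_norm_eq assms(1) by blast
qed (use assms in \<open>auto intro: exI[of _ 1]\<close>)

lemma clinearI:
  fixes f :: "'a::complex_inner \<Rightarrow> 'a"
  assumes "\<And>x y. f (x + y) = f x + f y" and "\<And>c x. f (c *\<^sub>C x) = c *\<^sub>C f x"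
  shows "clinear f"
  using assms by unfold_locales auto

text \<open>A surjective map that preserves inner products is automatically linear: moving \<open>U\<close> to the
  other side of the inner product turns linearity of \<open>U\<close> into linearity of the inner product
  in its first argument. The same argument gives antilinearity in \<open>antiunitaryI\<close>.\<close>

lemma unitaryI:
  fixes U :: "'a::complex_inner \<Rightarrow> 'a"
  assumes surj: "surj U" and ip: "\<And>x y. cinner (U x) (U y) = cinner x y"
  shows "unitary U"
proof -
  have 1: "cinner (U x) w = cinner x (inv U w)" for x w
    using ip[of x "inv U w"] surj by (simp add: surj_f_inv_f)
  have "U (x + y) = U x + U y" for x y
    by (rule cinner_eqI) (simp add: cinner_simps 1)
  moreover have "U (c *\<^sub>C x) = c *\<^sub>C U x" for c x
    by (rule cinner_eqI) (simp add: cinner_simps 1)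
  ultimately show ?thesis
    using assms by (auto simp: unitary_def intro: clinearI)
qed

lemma antiunitaryI:
  fixes U :: "'a::complex_inner \<Rightarrow> 'a"
  assumes surj: "surj U" and ip: "\<And>x y. cinner (U x) (U y) = cnj (cinner x y)"
  shows "antiunitary U"
proof -
  have 1: "cinner (U x) w = cnj (cinner x (inv U w))" for x w
    using ip[of x "inv U w"] surj by (simp add: surj_f_inv_f)
  have "U (x + y) = U x + U y" for x y
    by (rule cinner_eqI) (simp add: cinner_simps 1)
  moreover have "U (c *\<^sub>C x) = cnj c *\<^sub>C U x" for c x
    by (rule cinner_eqI) (simp add: cinner_simps 1)
  ultimately show ?thesis
    using assms by (auto simp: antiunitary_def antilinear_def)
qed

section \<open>Wigner's theorem\<close>

text \<open>Wigner's theorem, following Bargmann. Fix a unit vector \<open>e\<close> and put \<open>e' = T e\<close>. For \<open>x\<close>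
  orthogonal to \<open>e\<close>, exactly one vector on the line of \<open>T (e + x)\<close> has the form \<open>e' + V x\<close> with
  \<open>V x\<close> orthogonal to \<open>e'\<close>, which removes the freedom of phase. Comparing \<open>\<bar>1 + \<langle>x, y\<rangle>\<bar>\<close>
  and \<open>\<bar>\<langle>x, y\<rangle>\<bar>\<close> before and after shows that \<open>V\<close> preserves real parts of inner products, so \<open>V\<close>
  is real-linear. Each \<open>V (\<i> x)\<close> is \<open>\<i> V x\<close> or \<open>-\<i> V x\<close>, and the sign does not depend on \<open>x\<close>,
  since a group is not the union of two proper subgroups. Extending \<open>V\<close> by the identity or by
  complex conjugation on the coefficient along \<open>e\<close> gives \<open>U\<close>.\<close>

lemma wigner:
  fixes T :: "'a::complex_inner \<Rightarrow> 'a"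
  assumes pres: "\<And>x y. cmod (cinner (T x) (T y)) = cmod (cinner x y)"
    and onto: "\<And>y. \<exists>x c. cmod c = 1 \<and> T x = c *\<^sub>C y"
  shows "\<exists>U. (unitary U \<or> antiunitary U) \<and> (\<forall>x. \<exists>c. cmod c = 1 \<and> T x = c *\<^sub>C U x)"
proof (cases "\<exists>x :: 'a. x \<noteq> 0")
  case False
  then have "unitary (id :: 'a \<Rightarrow> 'a)"
    by (intro unitaryI) auto
  moreover have "T x = 1 *\<^sub>C id x" for x
    using False by metis
  ultimately show ?thesis
    by (metis norm_one)
next
  case True
  then obtain x0 :: 'a where "x0 \<noteq> 0" by blast
  then have "norm ((1 / norm x0) *\<^sub>R x0) = 1" by simp
  then obtain e :: 'a where e: "norm e = 1" by blast
  have ee: "cinner e e = 1" using e by (simp add: cinner_self)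
  have norm_T: "norm (T x) = norm x" for x
    using pres[of x x] by (simp add: cmod_cinner_self)
  define e' where "e' = T e"
  have ee': "cinner e' e' = 1" using e norm_T by (simp add: cinner_self e'_def)
  have parT: "\<exists>d. cmod d = 1 \<and> T y = d *\<^sub>C T x"
    if "y = c *\<^sub>C x" "cmod c = 1" for x y c
    using that by (intro cauchy_schwarz_equality_unit)
      (simp_all add: norm_T norm_scaleC pres cinner_simps norm_mult cmod_cinner_self power2_eq_square)
  (* the multiple of T (e + x) whose component along e' is 1 *)
  define W where "W x = cnj (cinner (T (e + x)) e') *\<^sub>C T (e + x)" for x
  define V where "V x = W x - e'" for x
  have W_phase: "cmod (cinner (T (e + x)) e') = 1" if "cinner x e = 0" for x
    using that by (simp add: e'_def pres cinner_simps ee)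
  have W_e': "cinner (W x) e' = 1" if "cinner x e = 0" for x
    using W_phase[OF that] by (simp add: W_def cinner_simps mult.commute complex_norm_square[symmetric])
  have W_V: "W x = e' + V x" for x by (simp add: V_def)
  have V_e': "cinner (V x) e' = 0" if "cinner x e = 0" for x
    using W_e'[OF that] by (simp add: V_def cinner_simps ee')
  have V_e'': "cinner e' (V x) = 0" if "cinner x e = 0" for x
    using V_e'[OF that] cinner_eq_0_commute by blast
  have V_shift: "cmod (1 + cinner (V x) (V y)) = cmod (1 + cinner x y)"
    if "cinner x e = 0" "cinner y e = 0" for x y
  proof -
    have "cinner e y = 0" using that(2) cinner_eq_0_commute by blast
    have "cmod (1 + cinner (V x) (V y)) = cmod (cinner (W x) (W y))"
      by (simp add: W_V cinner_simps ee' V_e' V_e'' that)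
    also have "\<dots> = cmod (cinner (e + x) (e + y))"
      by (simp add: W_def cinner_scaleC_left cinner_scaleC_right norm_mult W_phase that pres)
    also have "\<dots> = cmod (1 + cinner x y)"
      using \<open>cinner e y = 0\<close> that by (simp add: cinner_simps ee)
    finally show ?thesis .
  qed
  have norm_V: "norm (V x) = norm x" if "cinner x e = 0" for x
  proof -
    have "cmod (complex_of_real (1 + (norm (V x))\<^sup>2)) = cmod (complex_of_real (1 + (norm x)\<^sup>2))"
      using V_shift[OF that that] by (simp add: cinner_self)
    then show ?thesis
      by (simp only: norm_of_real) (simp add: abs_of_nonneg add_nonneg_nonneg)
  qed
  (* on the orthogonal complement of e the map V represents the same lines as T *)
  have V_T: "\<exists>d. cmod d = 1 \<and> T x = d *\<^sub>C V x" if x: "cinner x e = 0" for x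
  proof -
    have *: "cinner x e = 0" "cinner e x = 0" using x cinner_eq_0_commute by blast+
    have "cmod (cinner (T x) e') = 0"
      using * by (simp add: e'_def pres)
    then have "cmod (cinner (T x) (V x)) = cmod (cinner (T x) (W x))"
      by (simp add: W_V cinner_simps)
    also have "\<dots> = cmod (cinner x (e + x))"
      by (simp add: W_def cinner_scaleC_left cinner_scaleC_right norm_mult W_phase that pres)
    also have "\<dots> = norm (T x) * norm (V x)"
      using * by (simp add: cinner_simps cmod_cinner_self norm_T norm_V that power2_eq_square)
    finally show ?thesis
      by (intro cauchy_schwarz_equality_unit) (simp_all add: norm_T norm_V that)
  qed
  have V_mod: "cmod (cinner (V x) (V y)) = cmod (cinner x y)"
    if xy: "cinner x e = 0" "cinner y e = 0" for x y
  proof -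
    obtain c d where "cmod c = 1" "T x = c *\<^sub>C V x" "cmod d = 1" "T y = d *\<^sub>C V y"
      using V_T xy by meson
    then show ?thesis
      using pres[of x y] by (simp add: cinner_simps norm_mult)
  qed
  have V_Re: "inner (V x) (V y) = inner x y"
    if xy: "cinner x e = 0" "cinner y e = 0" for x y
  proof -
    have "(cmod (1 + z))\<^sup>2 = 1 + 2 * Re z + (cmod z)\<^sup>2" for z
      unfolding cmod_power2 by (simp add: power2_eq_square algebra_simps)
    from this[of "cinner x y"] this[of "cinner (V x) (V y)"] show ?thesis
      using V_shift[OF xy] V_mod[OF xy] by (simp add: Re_cinner)
  qed
  have V_add: "V (x + y) = V x + V y" if xy: "cinner x e = 0" "cinner y e = 0" for x y
  proof -
    have p: "cinner (x + y) e = 0" using xy by (simp add: cinner_simps)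
    have "inner (V (x + y) - (V x + V y)) (V (x + y) - (V x + V y)) = 0"
      by (simp add: inner_simps V_Re xy p)
    then show ?thesis by simp
  qed
  have V_i: "V (\<i> *\<^sub>C x) = \<i> *\<^sub>C V x \<or> V (\<i> *\<^sub>C x) = (- \<i>) *\<^sub>C V x"
    if x: "cinner x e = 0" for x
  proof (cases "x = 0")
    case True
    then have "V x = 0" using norm_V x by fastforce
    then show ?thesis using True by simp
  next
    case False
    have ix: "cinner (\<i> *\<^sub>C x) e = 0" using x by (simp add: cinner_simps)
    have "cmod (cinner (V (\<i> *\<^sub>C x)) (V x)) = norm (V (\<i> *\<^sub>C x)) * norm (V x)"
      by (simp add: V_mod x ix norm_V cinner_simps norm_mult norm_scaleC cmod_cinner_self power2_eq_square)
    then obtain c where c: "cmod c = 1" "V (\<i> *\<^sub>C x) = c *\<^sub>C V x"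
      using cauchy_schwarz_equality_unit[of "V (\<i> *\<^sub>C x)" "V x"] by (auto simp: norm_V x ix norm_scaleC)
    have "Re (cinner (V (\<i> *\<^sub>C x)) (V x)) = Re (cinner (\<i> *\<^sub>C x) x)"
      by (simp add: Re_cinner V_Re x ix)
    then have "Re c = 0"
      using False by (simp add: c(2) cinner_simps cinner_self norm_V x)
    then have "\<bar>Im c\<bar> = 1"
      using c(1) by (simp add: cmod_def)
    with \<open>Re c = 0\<close> have "c = \<i> \<or> c = - \<i>"
      by (auto simp: complex_eq_iff abs_if split: if_splits)
    then show ?thesis using c(2) by auto
  qed
  have V_linear: "(\<forall>x. cinner x e = 0 \<longrightarrow> V (\<i> *\<^sub>C x) = \<i> *\<^sub>C V x) \<or>
      (\<forall>x. cinner x e = 0 \<longrightarrow> V (\<i> *\<^sub>C x) = (- \<i>) *\<^sub>C V x)" (is "?lin \<or> ?anti")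
  proof (rule ccontr)
    (* x violates the first alternative and y the second; then x + y violates both *)
    assume neither: "\<not> (?lin \<or> ?anti)"
    obtain x where x: "cinner x e = 0" "V (\<i> *\<^sub>C x) \<noteq> \<i> *\<^sub>C V x"
      using neither by blast
    obtain y where y: "cinner y e = 0" "V (\<i> *\<^sub>C y) \<noteq> (- \<i>) *\<^sub>C V y"
      using neither by blast
    have "cinner (x + y) e = 0" "cinner (\<i> *\<^sub>C x) e = 0" "cinner (\<i> *\<^sub>C y) e = 0"
      using x y by (simp_all add: cinner_simps)
    then show False
      using V_i[of "x + y"] V_i[of x] V_i[of y] x y
      by (auto simp: V_add scaleC_add_right)
  qed
  have V_onto: "\<exists>x. cinner x e = 0 \<and> V x = y" if y: "cinner y e' = 0" for y
  proof -
    obtain u c where c: "cmod c = 1" "T u = c *\<^sub>C (e' + y)"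
      using onto by blast
    define b where "b = cinner u e"
    have b: "cmod b = 1"
      unfolding b_def pres[of u e, symmetric] e'_def[symmetric] c(2)
      using c(1) y by (simp add: cinner_simps ee')
    define x where "x = cnj b *\<^sub>C u - e"
    have x: "cinner x e = 0"
      using b by (simp add: x_def cinner_simps ee flip: b_def)
         (simp add: mult.commute complex_norm_square[symmetric])
    have "e + x = cnj b *\<^sub>C u" by (simp add: x_def)
    then obtain d where "T (e + x) = d *\<^sub>C T u"
      using parT[of "e + x" "cnj b" u] b by auto
    then obtain d' where d': "W x = d' *\<^sub>C (e' + y)"
      using c(2) by (auto simp: W_def scaleC_scaleC)
    then have "d' = 1"
      using W_e'[OF x] y by (simp add: cinner_simps ee')
    then show ?thesis
      using x d' by (auto simp: V_def)
  qed
  define p where "p x = x - cinner x e *\<^sub>C e" for x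
  have p: "cinner (p x) e = 0" for x
    by (simp add: p_def cinner_simps ee)
  have decomp: "cinner x y = cinner x e * cnj (cinner y e) + cinner (p x) (p y)" for x y
    using cinner_commute[of e y] by (simp add: p_def cinner_simps ee algebra_simps)
  (* g will be the identity or complex conjugation *)
  define U where "U g x = g (cinner x e) *\<^sub>C e' + V (p x)" for g x
  have U_onto: "surj (U g)" if g: "surj g" for g
  proof (rule surjI)
    fix y
    show "U g (SOME x. U g x = y) = y"
    proof (rule someI_ex)
      obtain a where a: "g a = cinner y e'" using g by (metis surj_def)
      have "cinner (y - cinner y e' *\<^sub>C e') e' = 0"
        by (simp add: cinner_simps ee')
      then obtain x where x: "cinner x e = 0" "V x = y - cinner y e' *\<^sub>C e'"
        using V_onto by blast
      have "U g (a *\<^sub>C e + x) = y"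
        using x by (simp add: U_def p_def cinner_simps ee a)
      then show "\<exists>x. U g x = y" by blast
    qed
  qed
  have U_ip: "cinner (U g x) (U g y) = g (cinner x e) * cnj (g (cinner y e)) + cinner (V (p x)) (V (p y))"
    for g x y
    by (simp add: U_def cinner_simps ee' V_e' V_e'' p)
  have U_T: "\<exists>c. cmod c = 1 \<and> T x = c *\<^sub>C U g x"
    if iso: "\<And>x y. cmod (cinner (U g x) (U g y)) = cmod (cinner x y)"
      and g: "g 0 = 0" "g 1 = 1" "\<And>a. cmod (g a) = cmod a" for g x
  proof (cases "cinner x e = 0")
    case True
    then show ?thesis
      using V_T[OF True] by (simp add: U_def p_def g)
  next
    case False
    define a where "a = cinner x e"
    (* rescale x so that its component along e becomes e itself, where T is described by W *)
    define u where "u = e + (1 / a) *\<^sub>C p x"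
    have "a \<noteq> 0" using False by (simp add: a_def)
    have x_u: "x = a *\<^sub>C u"
      using \<open>a \<noteq> 0\<close> by (simp add: u_def scaleC_add_right scaleC_scaleC p_def a_def)
    have perp: "cinner ((1 / a) *\<^sub>C p x) e = 0"
      by (simp add: cinner_simps p)
    have Uu: "U g u = W ((1 / a) *\<^sub>C p x)"
      using perp by (simp add: U_def p_def u_def W_V cinner_simps ee g p)
    have norm_U: "norm (U g y) = norm y" for y
      using iso[of y y] by (simp add: cmod_cinner_self)
    have "u \<noteq> 0" using perp ee by (auto simp: u_def cinner_simps dest: arg_cong[of _ _ "\<lambda>v. cinner v e"])
    then have "U g u \<noteq> 0" "T u \<noteq> 0" using norm_U[of u] norm_T[of u] by auto
    have sat: "cmod (cinner x u) = norm x * norm u"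
      by (simp add: x_u cinner_simps norm_mult norm_scaleC cmod_cinner_self power2_eq_square)
    obtain b where b: "T x = b *\<^sub>C T u"
      using cauchy_schwarz_equality[OF \<open>T u \<noteq> 0\<close>, of "T x"] sat by (auto simp: pres norm_T)
    obtain c where c: "U g x = c *\<^sub>C U g u"
      using cauchy_schwarz_equality[OF \<open>U g u \<noteq> 0\<close>, of "U g x"] sat by (auto simp: iso norm_U)
    define d where "d = cnj (cinner (T u) e')"
    have d: "U g u = d *\<^sub>C T u"
      using Uu by (simp only: W_def d_def u_def)
    have "c \<noteq> 0" "d \<noteq> 0"
      using c d \<open>U g u \<noteq> 0\<close> x_u \<open>a \<noteq> 0\<close> norm_U[of x] \<open>u \<noteq> 0\<close> by (auto simp: norm_scaleC)
    then have "T x = (b / (c * d)) *\<^sub>C U g x"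
      by (simp add: b c d scaleC_scaleC)
    then show ?thesis
      by (rule unit_multiple_if_norm_eq) (simp add: norm_T norm_U)
  qed
  from V_linear show ?thesis
  proof
    assume lin: ?lin
    have "cinner (V x) (V y) = cinner x y" if "cinner x e = 0" "cinner y e = 0" for x y
    proof (rule complex_eqI)
      have iy: "cinner (\<i> *\<^sub>C y) e = 0" using that by (simp add: cinner_simps)
      show "Re (cinner (V x) (V y)) = Re (cinner x y)"
        by (simp add: Re_cinner V_Re that)
      have "Im (cinner (V x) (V y)) = inner (V x) (V (\<i> *\<^sub>C y))"
        by (simp add: Im_cinner lin that)
      then show "Im (cinner (V x) (V y)) = Im (cinner x y)"
        by (simp add: Im_cinner V_Re that iy)
    qed
    then have ip: "cinner (U id x) (U id y) = cinner x y" for x y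
      by (subst decomp) (simp add: U_ip p)
    show ?thesis
      using unitaryI[OF U_onto ip] U_T[of id] ip by auto
  next
    assume anti: ?anti
    have "cinner (V x) (V y) = cnj (cinner x y)" if "cinner x e = 0" "cinner y e = 0" for x y
    proof (rule complex_eqI)
      have iy: "cinner (\<i> *\<^sub>C y) e = 0" using that by (simp add: cinner_simps)
      show "Re (cinner (V x) (V y)) = Re (cnj (cinner x y))"
        by (simp add: Re_cinner V_Re that)
      have "Im (cinner (V x) (V y)) = - inner (V x) (V (\<i> *\<^sub>C y))"
        by (simp add: Im_cinner anti that)
      then show "Im (cinner (V x) (V y)) = Im (cnj (cinner x y))"
        by (simp add: Im_cinner V_Re that iy)
    qed
    then have ip: "cinner (U cnj x) (U cnj y) = cnj (cinner x y)" for x y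
      by (subst decomp) (simp add: U_ip p)
    have "surj cnj" by (metis complex_cnj_cnj surjI)
    then show ?thesis
      using antiunitaryI[OF U_onto ip] U_T[of cnj] ip by auto
  qed
qed

section \<open>Effects\<close>

lemma selfadjointI:
  fixes A :: "'a::complex_inner \<Rightarrow>\<^sub>L 'a"
  assumes "\<And>x y. cinner (A x) y = cinner x (A y)"
  shows "selfadjoint A"
proof -
  have "A (c *\<^sub>C x) = c *\<^sub>C A x" for c x
    by (rule cinner_eqI) (simp add: assms cinner_scaleC_left)
  then show ?thesis
    using assms by (auto simp: selfadjoint_def blinfun.add_right intro: clinearI)
qed

lemma selfadjointD: "selfadjoint A \<Longrightarrow> cinner (A x) y = cinner x (A y)"
  by (simp add: selfadjoint_def)

lemma selfadjoint_inner: "selfadjoint A \<Longrightarrow> inner (A x) y = inner x (A y)"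
  by (metis Re_cinner selfadjointD)

lemma selfadjoint_scaleC: "selfadjoint A \<Longrightarrow> A (c *\<^sub>C x) = c *\<^sub>C A x"
  by (rule cinner_eqI) (simp add: selfadjointD cinner_scaleC_left)

lemma selfadjoint_0: "selfadjoint 0"
  and selfadjoint_id: "selfadjoint id_blinfun"
  and selfadjoint_add: "selfadjoint A \<Longrightarrow> selfadjoint B \<Longrightarrow> selfadjoint (A + B)"
  and selfadjoint_diff: "selfadjoint A \<Longrightarrow> selfadjoint B \<Longrightarrow> selfadjoint (A - B)"
  and selfadjoint_scaleR: "selfadjoint A \<Longrightarrow> selfadjoint (r *\<^sub>R A)"
  and selfadjoint_sandwich: "selfadjoint A \<Longrightarrow> selfadjoint B \<Longrightarrow> selfadjoint (A o\<^sub>L B o\<^sub>L A)"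
  and selfadjoint_square: "selfadjoint A \<Longrightarrow> selfadjoint (A o\<^sub>L A)"
  by (auto intro!: selfadjointI simp: cinner_simps blinfun.add_left blinfun.diff_left
      blinfun.scaleR_left selfadjointD)

lemma selfadjoint_limit:
  assumes "\<And>n. selfadjoint (Y n)" and "Y \<longlonglongrightarrow> L"
  shows "selfadjoint L"
proof (rule selfadjointI)
  fix x y
  have lim: "(\<lambda>n. Y n z) \<longlonglongrightarrow> L z" for z
    using assms(2) by (intro blinfun.tendsto tendsto_const)
  have sym: "inner (Y n x) y = inner x (Y n y)" "inner (Y n x) (\<i> *\<^sub>C y) = inner x (\<i> *\<^sub>C Y n y)" for n
    by (simp_all add: selfadjoint_inner selfadjoint_scaleC assms(1))
  have tend_i: "(\<lambda>n. inner x (\<i> *\<^sub>C Y n y)) \<longlonglongrightarrow> inner x (\<i> *\<^sub>C L y)"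
  proof -
    have "inner x (\<i> *\<^sub>C v) = inner ((- \<i>) *\<^sub>C x) v" for v
      by (simp only: Re_cinner[symmetric] cinner_simps) simp
    then show ?thesis
      by (simp only:) (intro tendsto_intros lim)
  qed
  show "cinner (L x) y = cinner x (L y)"
  proof (rule complex_eqI)
    have "(\<lambda>n. inner (Y n x) y) \<longlonglongrightarrow> inner (L x) y"
      by (intro tendsto_intros lim)
    moreover have "(\<lambda>n. inner (Y n x) y) \<longlonglongrightarrow> inner x (L y)"
      unfolding sym by (intro tendsto_intros lim)
    ultimately show "Re (cinner (L x) y) = Re (cinner x (L y))"
      unfolding Re_cinner by (rule LIMSEQ_unique)
    have "(\<lambda>n. inner (Y n x) (\<i> *\<^sub>C y)) \<longlonglongrightarrow> inner (L x) (\<i> *\<^sub>C y)"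
      by (intro tendsto_intros lim)
    moreover have "(\<lambda>n. inner (Y n x) (\<i> *\<^sub>C y)) \<longlonglongrightarrow> inner x (\<i> *\<^sub>C L y)"
      unfolding sym by (rule tend_i)
    ultimately show "Im (cinner (L x) y) = Im (cinner x (L y))"
      unfolding Im_cinner by (rule LIMSEQ_unique)
  qed
qed

lemma effects_iff:
  "A \<in> effects \<longleftrightarrow> selfadjoint A \<and> (\<forall>x. 0 \<le> inner (A x) x \<and> inner (A x) x \<le> (norm x)\<^sup>2)"
  by (auto simp: effects_def op_le_def selfadjoint_0 selfadjoint_id Re_cinner power2_norm_eq_inner)

lemma effect_selfadjoint: "A \<in> effects \<Longrightarrow> selfadjoint A"
  and effect_nonneg: "A \<in> effects \<Longrightarrow> 0 \<le> inner (A x) x"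
  and effect_le: "A \<in> effects \<Longrightarrow> inner (A x) x \<le> (norm x)\<^sup>2"
  by (simp_all add: effects_iff)

lemma effect_0: "0 \<in> effects"
  and effect_id: "id_blinfun \<in> effects"
  by (simp_all add: effects_iff selfadjoint_0 selfadjoint_id power2_norm_eq_inner)

lemma effect_complement: "A \<in> effects \<Longrightarrow> id_blinfun - A \<in> effects"
  by (auto simp: effects_iff selfadjoint_id blinfun.diff_left inner_diff_left power2_norm_eq_inner
      intro: selfadjoint_diff)

text \<open>This single estimate replaces the Cauchy--Schwarz inequality for positive operators: expand
  \<open>\<langle>A (x - A x), x - A x\<rangle> \<ge> 0\<close> and bound the last term by \<open>A \<le> I\<close>. It yields both that effects
  are contractions and that \<open>\<langle>A x, x\<rangle> = 0\<close> forces \<open>A x = 0\<close>.\<close>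

lemma effect_norm_square_le:
  assumes "A \<in> effects"
  shows "(norm (A x))\<^sup>2 \<le> inner (A x) x"
proof -
  have "0 \<le> inner (A (x - A x)) (x - A x)"
    by (rule effect_nonneg[OF assms])
  also have "\<dots> = inner (A x) x - 2 * (norm (A x))\<^sup>2 + inner (A (A x)) (A x)"
    using selfadjoint_inner[OF effect_selfadjoint[OF assms], of "A x" x]
    by (simp add: blinfun.diff_right inner_simps power2_norm_eq_inner)
  also have "\<dots> \<le> inner (A x) x - (norm (A x))\<^sup>2"
    using effect_le[OF assms, of "A x"] by linarith
  finally show ?thesis by linarith
qed

lemma effect_norm_le:
  assumes "A \<in> effects"
  shows "norm (A x) \<le> norm x"
  by (rule power2_le_imp_le[OF order_trans[OF effect_norm_square_le[OF assms] effect_le[OF assms]] norm_ge_zero])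

lemma effect_eq_0_if_inner_eq_0:
  assumes "A \<in> effects" and "inner (A x) x = 0"
  shows "A x = 0"
  using effect_norm_square_le[OF assms(1), of x] assms(2) by simp

lemma effect_sandwich:
  assumes A: "A \<in> effects" and B: "B \<in> effects"
  shows "A o\<^sub>L B o\<^sub>L A \<in> effects"
proof -
  have "inner ((A o\<^sub>L B o\<^sub>L A) x) x = inner (B (A x)) (A x)" for x
    using selfadjoint_inner[OF effect_selfadjoint[OF A]] by simp
  moreover have "inner (B (A x)) (A x) \<le> (norm x)\<^sup>2" for x
    using order_trans[OF effect_le[OF B] power_mono[OF effect_norm_le[OF A] norm_ge_zero]] .
  ultimately show ?thesis
    using assms by (auto simp: effects_iff intro: selfadjoint_sandwich)
qed

lemma blinfun_compose_assoc: "(A o\<^sub>L B) o\<^sub>L C = A o\<^sub>L (B o\<^sub>L C)"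
  by (rule blinfun_eqI) simp

lemma compose_id_blinfun: "A o\<^sub>L id_blinfun = A"
  by (rule blinfun_eqI) simp

lemma effect_square: "A o\<^sub>L A \<in> effects" if "A \<in> effects"
  using effect_sandwich[OF that effect_id] by (simp only: compose_id_blinfun)

text \<open>\<open>A B A = 0\<close> makes the quadratic form of \<open>B\<close> vanish on the range of \<open>A\<close>. Thus the zero product
  is expressible by the triple product.\<close>

lemma effect_sandwich_eq_0_iff:
  assumes A: "A \<in> effects" and B: "B \<in> effects"
  shows "A o\<^sub>L B o\<^sub>L A = 0 \<longleftrightarrow> B o\<^sub>L A = 0"
proof
  assume 0: "A o\<^sub>L B o\<^sub>L A = 0"
  have "B (A x) = 0" for x
  proof (rule effect_eq_0_if_inner_eq_0[OF B])
    have "A (B (A x)) = 0"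
      using arg_cong[OF 0, of "\<lambda>f. blinfun_apply f x"] by simp
    then show "inner (B (A x)) (A x) = 0"
      using selfadjoint_inner[OF effect_selfadjoint[OF A], of "B (A x)" x] by simp
  qed
  then show "B o\<^sub>L A = 0"
    by (intro blinfun_eqI) simp
qed (simp add: blinfun_compose_assoc)

lemma selfadjoint_compose_eq_0_commute:
  fixes A B :: "'a::complex_inner \<Rightarrow>\<^sub>L 'a"
  assumes A: "selfadjoint A" and B: "selfadjoint B" and "A o\<^sub>L B = 0"
  shows "B o\<^sub>L A = 0"
proof (rule blinfun_eqI, rule cinner_eqI)
  fix x z
  have "A (B z) = 0"
    using arg_cong[OF assms(3), of "\<lambda>f. blinfun_apply f z"] by simp
  then show "cinner ((B o\<^sub>L A) x) z = cinner ((0 :: 'a \<Rightarrow>\<^sub>L 'a) x) z"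
    by (simp add: selfadjointD[OF A] selfadjointD[OF B])
qed

section \<open>Square roots of effects\<close>

instance complex_hilbert_space \<subseteq> banach ..

text \<open>For an effect \<open>A = I - T\<close>, a solution of \<open>Y = (T + Y\<^sup>2)/2\<close> gives \<open>(I - Y)\<^sup>2 = A\<close>. The iteration
  for \<open>Y\<close> is compared with the same iteration for the number 1 in place of \<open>T\<close>, which increases
  and stays below 1: since \<open>\<parallel>T\<parallel> \<le> 1\<close>, its increments dominate those of the operator iteration in norm, so the
  latter converges in norm.\<close>


text \<open>The symmetric form of the factorisation of a difference of squares, valid without commutation.\<close>

lemma square_diff:
  "(C o\<^sub>L C) - (D o\<^sub>L D) = (1/2) *\<^sub>R (((C - D) o\<^sub>L (C + D)) + ((C + D) o\<^sub>L (C - D)))"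
proof (rule blinfun_eqI)
  fix x
  have "(((C - D) o\<^sub>L (C + D)) + ((C + D) o\<^sub>L (C - D))) x = (C (C x) - D (D x)) + (C (C x) - D (D x))"
    by (simp add: blinfun.bilinear_simps algebra_simps)
  then show "((C o\<^sub>L C) - (D o\<^sub>L D)) x
      = ((1/2) *\<^sub>R (((C - D) o\<^sub>L (C + D)) + ((C + D) o\<^sub>L (C - D)))) x"
    by (simp only: blinfun.scaleR_left scaleR_half_double) (simp add: blinfun.diff_left)
qed

primrec root_iter :: "('a::real_normed_vector \<Rightarrow>\<^sub>L 'a) \<Rightarrow> nat \<Rightarrow> ('a \<Rightarrow>\<^sub>L 'a)" where
  "root_iter T 0 = 0"
| "root_iter T (Suc n) = (1/2) *\<^sub>R (T + (root_iter T n o\<^sub>L root_iter T n))"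

primrec root_bound :: "nat \<Rightarrow> real" where
  "root_bound 0 = 0"
| "root_bound (Suc n) = (1 + (root_bound n)\<^sup>2) / 2"

lemma root_bound_range: "0 \<le> root_bound n \<and> root_bound n \<le> 1"
proof (induction n)
  case (Suc n)
  then have "(root_bound n)\<^sup>2 \<le> 1" by (simp add: power_le_one)
  then show ?case by simp
qed simp

lemma root_bound_mono: "incseq root_bound"
proof (rule incseq_SucI)
  fix n
  have "0 \<le> (1 - root_bound n)\<^sup>2" by simp
  then show "root_bound n \<le> root_bound (Suc n)"
    by (simp add: power2_eq_square algebra_simps)
qed

lemma norm_root_iter:
  assumes "norm T \<le> 1"
  shows "norm (root_iter T n) \<le> root_bound n"
proof (induction n)
  case (Suc n)
  have "norm (root_iter T n o\<^sub>L root_iter T n) \<le> norm (root_iter T n) * norm (root_iter T n)"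
    by (rule norm_blinfun_compose)
  also have "\<dots> \<le> (root_bound n)\<^sup>2"
    unfolding power2_eq_square using Suc root_bound_range[of n] by (intro mult_mono) auto
  finally show ?case
    using assms norm_triangle_ineq[of T "root_iter T n o\<^sub>L root_iter T n"] by simp
qed simp

lemma norm_root_iter_step:
  assumes "norm T \<le> 1"
  shows "norm (root_iter T (Suc n) - root_iter T n) \<le> root_bound (Suc n) - root_bound n"
proof (induction n)
  case 0
  then show ?case using assms by simp
next
  case (Suc n)
  let ?Y = "root_iter T n" and ?Z = "root_iter T (Suc n)"
  let ?y = "root_bound n" and ?z = "root_bound (Suc n)"
  define D where "D = ?Z - ?Y"
  define S where "S = ?Z + ?Y"
  have D: "norm D \<le> ?z - ?y"
    using Suc unfolding D_def .
  have S: "norm S \<le> ?z + ?y"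
    unfolding S_def
    by (rule norm_triangle_le[OF add_mono[OF norm_root_iter[OF assms] norm_root_iter[OF assms]]])
  have "norm ((D o\<^sub>L S) + (S o\<^sub>L D)) \<le> norm D * norm S + norm S * norm D"
    by (rule norm_triangle_le[OF add_mono[OF norm_blinfun_compose norm_blinfun_compose]])
  also have "\<dots> \<le> 2 * ((?z - ?y) * (?z + ?y))"
    using mult_mono'[OF D S norm_ge_zero norm_ge_zero] by (simp only: mult.commute mult_2)
  finally have DS: "norm ((D o\<^sub>L S) + (S o\<^sub>L D)) \<le> 2 * ((?z - ?y) * (?z + ?y))" .
  have "root_iter T (Suc (Suc n)) - root_iter T (Suc n) = (1/2) *\<^sub>R ((?Z o\<^sub>L ?Z) - (?Y o\<^sub>L ?Y))"
    unfolding root_iter.simps(2)[of T "Suc n"] root_iter.simps(2)[of T n, symmetric]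
    by (subst (2) root_iter.simps(2)) (simp add: scaleR_right_diff_distrib scaleR_right_distrib del: root_iter.simps)
  also have "\<dots> = (1/4) *\<^sub>R ((D o\<^sub>L S) + (S o\<^sub>L D))"
    unfolding square_diff D_def S_def by (simp only: scaleR_scaleR) simp
  finally have "norm (root_iter T (Suc (Suc n)) - root_iter T (Suc n))
      = (1/4) * norm ((D o\<^sub>L S) + (S o\<^sub>L D))"
    by simp
  also have "\<dots> \<le> (1/4) * (2 * ((?z - ?y) * (?z + ?y)))"
    using DS by simp
  also have "\<dots> = root_bound (Suc (Suc n)) - root_bound (Suc n)"
    unfolding root_bound.simps(2)[of "Suc n"]
    by (subst (4) root_bound.simps(2)) (simp add: field_simps power2_eq_square del: root_bound.simps)
  finally show ?case .
qed

lemma root_iter_convergent: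
  fixes T :: "'a::banach \<Rightarrow>\<^sub>L 'a"
  assumes "norm T \<le> 1"
  shows "convergent (root_iter T)"
proof -
  have tele: "norm (root_iter T (m + k) - root_iter T m) \<le> root_bound (m + k) - root_bound m" for m k
  proof (induction k)
    case (Suc k)
    show ?case
      using norm_triangle_mono[OF norm_root_iter_step[OF assms, of "m + k"] Suc]
      by (simp del: root_iter.simps root_bound.simps)
  qed simp
  have "Cauchy root_bound"
    using root_bound_range root_bound_mono
    by (intro convergent_Cauchy) (metis Bseq_monoseq_convergent incseq_bounded incseq_convergent convergent_def)
  then have "Cauchy (root_iter T)"
    unfolding Cauchy_altdef2
  proof (intro allI impI)
    fix e :: real
    assume "\<forall>e>0. \<exists>N. \<forall>n\<ge>N. dist (root_bound n) (root_bound N) < e" and "e > 0"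
    then obtain N where N: "\<And>n. n \<ge> N \<Longrightarrow> dist (root_bound n) (root_bound N) < e" by blast
    have "dist (root_iter T n) (root_iter T N) < e" if "n \<ge> N" for n
      using N[OF that] tele[of N "n - N"] that by (simp add: dist_norm)
    then show "\<exists>N. \<forall>n\<ge>N. dist (root_iter T n) (root_iter T N) < e" by blast
  qed
  then show ?thesis by (rule Cauchy_convergent)
qed

text \<open>The root is a norm limit of polynomials in \<open>A\<close>, so it commutes with whatever commutes with \<open>A\<close>;
  uniqueness of the root rests on this.\<close>

lemma effect_has_root:
  fixes A :: "'a::complex_hilbert_space \<Rightarrow>\<^sub>L 'a"
  assumes A: "A \<in> effects"
  shows "\<exists>R\<in>effects. R o\<^sub>L R = A \<and> (\<forall>B. B o\<^sub>L A = A o\<^sub>L B \<longrightarrow> B o\<^sub>L R = R o\<^sub>L B)"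
proof -
  define T where "T = id_blinfun - A"
  have T: "T \<in> effects" unfolding T_def by (rule effect_complement[OF A])
  have norm_T: "norm T \<le> 1"
    by (rule norm_blinfun_bound) (simp_all add: effect_norm_le[OF T])
  obtain Y where Y: "root_iter T \<longlonglongrightarrow> Y"
    using root_iter_convergent[OF norm_T] by (auto simp: convergent_def)
  have sa_iter: "selfadjoint (root_iter T n)" for n
    by (induction n) (simp_all add: selfadjoint_0 selfadjoint_scaleR selfadjoint_add
        selfadjoint_square effect_selfadjoint[OF T])
  have sa_Y: "selfadjoint Y"
    by (rule selfadjoint_limit[OF sa_iter Y])
  note compose_tendsto = bounded_bilinear.tendsto[OF bounded_bilinear_blinfun_compose]
  have "(\<lambda>n. root_iter T (Suc n)) \<longlonglongrightarrow> (1/2) *\<^sub>R (T + (Y o\<^sub>L Y))"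
    by (simp only: root_iter.simps) (intro tendsto_intros compose_tendsto Y)
  then have fix_Y: "Y = (1/2) *\<^sub>R (T + (Y o\<^sub>L Y))"
    using LIMSEQ_Suc[OF Y] LIMSEQ_unique by blast
  have norm_Y: "norm Y \<le> 1"
  proof (rule LIMSEQ_le_const2[OF tendsto_norm[OF Y]])
    show "\<exists>N. \<forall>n\<ge>N. norm (root_iter T n) \<le> 1"
      using norm_root_iter[OF norm_T] root_bound_range order_trans by blast
  qed
  define R where "R = id_blinfun - Y"
  have sq: "R o\<^sub>L R = A"
  proof (rule blinfun_eqI)
    fix x
    have "2 *\<^sub>R Y x = T x + Y (Y x)"
      by (subst fix_Y) (simp add: blinfun.bilinear_simps)
    then show "(R o\<^sub>L R) x = A x"
      by (simp add: R_def T_def blinfun.bilinear_simps scaleR_2 algebra_simps)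
  qed
  have sa_R: "selfadjoint R"
    unfolding R_def by (intro selfadjoint_diff selfadjoint_id sa_Y)
  have "R \<in> effects"
    unfolding effects_iff
  proof (intro conjI sa_R allI)
    fix x
    have "inner (Y x) x \<le> norm (Y x) * norm x"
      by (rule norm_cauchy_schwarz)
    also have "\<dots> \<le> (norm x)\<^sup>2"
      using norm_blinfun[of Y x] mult_right_mono[OF norm_Y, of "norm x"]
      by (simp add: power2_eq_square mult_right_mono)
    finally show "0 \<le> inner (R x) x"
      by (simp add: R_def blinfun.diff_left inner_diff_left power2_norm_eq_inner)
    have "(norm (R x))\<^sup>2 = inner (A x) x"
      unfolding sq[symmetric] power2_norm_eq_inner by (simp add: selfadjoint_inner[OF sa_R])
    then have "(norm (R x))\<^sup>2 \<le> (norm x)\<^sup>2"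
      using effect_le[OF A] by simp
    then have "norm (R x) \<le> norm x" by simp
    then have "norm (R x) * norm x \<le> (norm x)\<^sup>2"
      by (simp add: power2_eq_square mult_right_mono)
    then show "inner (R x) x \<le> (norm x)\<^sup>2"
      using norm_cauchy_schwarz[of "R x" x] by linarith
  qed
  moreover have "B o\<^sub>L R = R o\<^sub>L B" if B: "B o\<^sub>L A = A o\<^sub>L B" for B
  proof -
    have BA: "B (A x) = A (B x)" for x
      using arg_cong[OF B, of "\<lambda>f. blinfun_apply f x"] by simp
    have "B o\<^sub>L root_iter T n = root_iter T n o\<^sub>L B" for n
    proof (induction n)
      case (Suc n)
      have "B (root_iter T n x) = root_iter T n (B x)" for x
        using arg_cong[OF Suc, of "\<lambda>f. blinfun_apply f x"] by simp
      then show ?case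
        by (intro blinfun_eqI) (simp add: T_def blinfun.bilinear_simps BA)
    qed (simp add: blinfun_eqI)
    moreover have "(\<lambda>n. B o\<^sub>L root_iter T n) \<longlonglongrightarrow> (B o\<^sub>L Y)" "(\<lambda>n. root_iter T n o\<^sub>L B) \<longlonglongrightarrow> (Y o\<^sub>L B)"
      by (intro compose_tendsto tendsto_const Y)+
    ultimately have "B o\<^sub>L Y = Y o\<^sub>L B"
      by (simp only: LIMSEQ_unique)
    then have "B (Y x) = Y (B x)" for x
      by (auto dest: arg_cong[of _ _ "\<lambda>f. blinfun_apply f x"])
    then show ?thesis
      by (intro blinfun_eqI) (simp add: R_def blinfun.bilinear_simps)
  qed
  ultimately show ?thesis
    using sq by blast
qed

text \<open>Both \<open>R\<close> and \<open>C\<close> commute with their common square, hence with the root \<open>S\<close> of it constructed in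
  \<open>effect_has_root\<close>, so it suffices to compare commuting roots. If \<open>R\<close> and \<open>S\<close> commute and have the
  same square, then \<open>(R + S) (R - S) = 0\<close>; for \<open>u = (R - S) x\<close> the forms \<open>\<langle>R u, u\<rangle>\<close> and
  \<open>\<langle>S u, u\<rangle>\<close> are nonnegative with sum zero. So \<open>R u = S u = 0\<close> and \<open>\<parallel>u\<parallel>\<^sup>2 = \<langle>(R - S) u, x\<rangle> = 0\<close>.\<close>

lemma effect_square_inj:
  fixes R C :: "'a::complex_hilbert_space \<Rightarrow>\<^sub>L 'a"
  assumes R: "R \<in> effects" and C: "C \<in> effects" and sq: "R o\<^sub>L R = C o\<^sub>L C"
  shows "R = C"
proof -
  have unique: "R = S"
    if R: "R \<in> effects" and S: "S \<in> effects" and sq: "R o\<^sub>L R = S o\<^sub>L S" and comm: "R o\<^sub>L S = S o\<^sub>L R"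
    for R S :: "'a \<Rightarrow>\<^sub>L 'a"
  proof (rule blinfun_eqI)
    fix x
    have sqx: "R (R z) = S (S z)" and commx: "R (S z) = S (R z)" for z
      using arg_cong[OF sq, of "\<lambda>f. blinfun_apply f z"] arg_cong[OF comm, of "\<lambda>f. blinfun_apply f z"]
      by simp_all
    let ?u = "R x - S x"
    have "R ?u + S ?u = 0"
      by (simp add: blinfun.diff_right sqx commx)
    then have "inner (R ?u) ?u + inner (S ?u) ?u = 0"
      by (metis inner_add_left inner_zero_left)
    then have "inner (R ?u) ?u = 0" "inner (S ?u) ?u = 0"
      using effect_nonneg[OF R, of ?u] effect_nonneg[OF S, of ?u] by linarith+
    then have "R ?u = 0" "S ?u = 0"
      using effect_eq_0_if_inner_eq_0 R S by blast+
    moreover have "inner ?u ?u = inner (R ?u) x - inner (S ?u) x"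
      using selfadjoint_inner[OF effect_selfadjoint[OF R], of ?u x]
        selfadjoint_inner[OF effect_selfadjoint[OF S], of ?u x]
      by (simp add: inner_diff_right)
    ultimately have "inner ?u ?u = 0" by simp
    then show "R x = S x" by simp
  qed
  obtain S where S: "S \<in> effects" "S o\<^sub>L S = R o\<^sub>L R"
    "\<And>B. B o\<^sub>L (R o\<^sub>L R) = (R o\<^sub>L R) o\<^sub>L B \<Longrightarrow> B o\<^sub>L S = S o\<^sub>L B"
    using effect_has_root[OF effect_square[OF R]] by blast
  have "R = S"
    using unique[OF R S(1)] S(2) S(3)[of R] by (simp add: blinfun_compose_assoc)
  moreover have "C = S"
    using unique[OF C S(1)] S(2) S(3)[of C] sq by (simp add: blinfun_compose_assoc)
  ultimately show ?thesis by simp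
qed

text \<open>Positive operators that square to \<open>R\<^sup>2\<close> are contractions, hence effects, so uniqueness among
  effects is enough.\<close>

lemma sqrt_op_square:
  fixes R :: "'a::complex_hilbert_space \<Rightarrow>\<^sub>L 'a"
  assumes R: "R \<in> effects"
  shows "sqrt_op (R o\<^sub>L R) = R"
  unfolding sqrt_op_def
proof (rule the_equality)
  show "0 \<preceq> R \<and> R o\<^sub>L R = R o\<^sub>L R"
    using R by (simp add: effects_def)
next
  fix S :: "'a \<Rightarrow>\<^sub>L 'a"
  assume S: "0 \<preceq> S \<and> S o\<^sub>L S = R o\<^sub>L R"
  then have sa: "selfadjoint S" and pos: "0 \<le> inner (S x) x" for x
    by (auto simp: op_le_def Re_cinner)
  have "norm (S x) \<le> norm x" for x
  proof (rule power2_le_imp_le)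
    have "(norm (S x))\<^sup>2 = inner ((S o\<^sub>L S) x) x"
      by (simp add: power2_norm_eq_inner selfadjoint_inner[OF sa])
    then show "(norm (S x))\<^sup>2 \<le> (norm x)\<^sup>2"
      using S effect_le[OF effect_square[OF R]] by simp
  qed simp
  then have "inner (S x) x \<le> (norm x)\<^sup>2" for x
    using norm_cauchy_schwarz[of "S x" x] mult_right_mono[of "norm (S x)" "norm x" "norm x"]
    by (fastforce simp: power2_eq_square)
  then have "S \<in> effects"
    using sa pos by (simp add: effects_iff)
  then show "S = R"
    using effect_square_inj R S by blast
qed

section \<open>Rank-one projections\<close>

text \<open>For a unit vector \<open>x\<close> this is the orthogonal projection onto the line of \<open>x\<close>.\<close>

lift_definition ray :: "'a::complex_inner \<Rightarrow> ('a \<Rightarrow>\<^sub>L 'a)" is "\<lambda>x y. cinner y x *\<^sub>C x"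
proof (rule bounded_linear_intro)
  fix x y z :: 'a and r :: real
  show "cinner (y + z) x *\<^sub>C x = cinner y x *\<^sub>C x + cinner z x *\<^sub>C x"
    by (simp add: cinner_add_left scaleC_add_left)
  show "cinner (r *\<^sub>R y) x *\<^sub>C x = r *\<^sub>R (cinner y x *\<^sub>C x)"
    by (simp add: cinner_scaleC_left scaleR_scaleC scaleC_scaleC)
  show "norm (cinner y x *\<^sub>C x) \<le> norm y * (norm x)\<^sup>2"
    using mult_right_mono[OF cmod_cinner_le[of y x], of "norm x"]
    by (simp add: norm_scaleC power2_eq_square mult.assoc)
qed

lemma inner_ray: "inner (ray x y) y = (cmod (cinner y x))\<^sup>2"
proof -
  have "cinner (ray x y) y = cinner y x * cnj (cinner y x)"
    using cinner_commute[of x y] by (simp add: ray.rep_eq cinner_scaleC_left)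
  then show ?thesis
    by (simp flip: Re_cinner add: complex_norm_square[symmetric])
qed

lemma selfadjoint_ray: "selfadjoint (ray x)"
proof (rule selfadjointI)
  fix y z
  show "cinner (ray x y) z = cinner y (ray x z)"
    using cinner_commute[of z x] by (simp add: ray.rep_eq cinner_scaleC_left cinner_scaleC_right)
qed

lemma effect_ray:
  assumes "norm x = 1"
  shows "ray x \<in> effects"
  unfolding effects_iff
proof (intro conjI selfadjoint_ray allI)
  fix y
  show "0 \<le> inner (ray x y) y" by (simp add: inner_ray)
  show "inner (ray x y) y \<le> (norm y)\<^sup>2"
    using power_mono[OF cmod_cinner_le[of y x] norm_ge_zero, of 2] assms by (simp add: inner_ray)
qed

lemma ray_self: "norm x = 1 \<Longrightarrow> ray x x = x"
  by (simp add: ray.rep_eq cinner_self)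

lemma ray_sandwich:
  assumes "selfadjoint A"
  shows "ray x o\<^sub>L A o\<^sub>L ray x = inner (A x) x *\<^sub>R ray x"
proof (rule blinfun_eqI)
  fix y
  have "cinner (A x) x = complex_of_real (inner (A x) x)"
    using selfadjointD[OF assms, of x x] cinner_commute[of "A x" x]
    by (auto simp: complex_eq_iff Re_cinner)
  then show "(ray x o\<^sub>L A o\<^sub>L ray x) y = (inner (A x) x *\<^sub>R ray x) y"
    by (simp add: ray.rep_eq selfadjoint_scaleC[OF assms] cinner_scaleC_left blinfun.scaleR_left
        scaleR_scaleC scaleC_scaleC mult.commute)
qed

lemma ray_idem: "norm x = 1 \<Longrightarrow> ray x o\<^sub>L ray x = ray x"
  using ray_sandwich[OF selfadjoint_id, of x]
  by (simp add: compose_id_blinfun flip: power2_norm_eq_inner)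

lemma ray_eq_parallel:
  assumes "norm x = 1" "norm y = 1" "ray x = ray y"
  shows "\<exists>c. cmod c = 1 \<and> x = c *\<^sub>C y"
proof -
  have "x = cinner x y *\<^sub>C y"
    using ray_self[OF assms(1)] unfolding assms(3) by (simp add: ray.rep_eq)
  then show ?thesis
    by (rule unit_multiple_if_norm_eq) (simp add: assms)
qed

definition is_proj :: "('a::complex_inner \<Rightarrow>\<^sub>L 'a) \<Rightarrow> bool" where
  "is_proj P \<longleftrightarrow> P \<in> effects \<and> P o\<^sub>L P = P"

text \<open>Minimality is phrased by the triple product \<open>P Q P = Q\<close>, which for projections means \<open>Q \<le> P\<close>, so
  that maps preserving triple products visibly respect it.\<close>

definition minimal_proj :: "('a::complex_inner \<Rightarrow>\<^sub>L 'a) \<Rightarrow> bool" where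
  "minimal_proj P \<longleftrightarrow> is_proj P \<and> P \<noteq> 0 \<and>
     (\<forall>Q. is_proj Q \<and> P o\<^sub>L Q o\<^sub>L P = Q \<longrightarrow> Q = 0 \<or> Q = P)"

text \<open>A nonzero projection dominates the rank-one projection onto any unit vector of its range. Conversely,
  \<open>P\<^sub>x Q P\<^sub>x\<close> is a multiple of \<open>P\<^sub>x\<close>, and a multiple \<open>r P\<^sub>x\<close> is idempotent only for \<open>r = 0\<close> and \<open>r = 1\<close>.\<close>

lemma minimal_proj_iff_ray: "minimal_proj P \<longleftrightarrow> (\<exists>x. norm x = 1 \<and> P = ray x)"
proof
  assume P: "minimal_proj P"
  then have PP: "P (P z) = P z" for z
    unfolding minimal_proj_def is_proj_def by (metis blinfun_apply_blinfun_compose)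
  obtain z where z: "P z \<noteq> 0"
    using P unfolding minimal_proj_def by (metis blinfun_eqI zero_blinfun.rep_eq)
  define x where "x = (1 / norm (P z)) *\<^sub>R P z"
  have x: "norm x = 1" "P x = x"
    using z by (simp_all add: x_def blinfun.scaleR_right PP)
  have sa: "selfadjoint P"
    using P by (simp add: minimal_proj_def is_proj_def effect_selfadjoint)
  have "P o\<^sub>L ray x o\<^sub>L P = ray x"
  proof (rule blinfun_eqI)
    fix y
    have "cinner (P y) x = cinner y x"
      by (simp add: selfadjointD[OF sa] x)
    then show "(P o\<^sub>L ray x o\<^sub>L P) y = ray x y"
      by (simp add: ray.rep_eq selfadjoint_scaleC[OF sa] x)
  qed
  moreover have "is_proj (ray x)"
    using x by (simp add: is_proj_def effect_ray ray_idem)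
  moreover have "ray x \<noteq> 0"
    using x ray_self[of x] by auto
  ultimately show "\<exists>x. norm x = 1 \<and> P = ray x"
    using P x unfolding minimal_proj_def by metis
next
  assume "\<exists>x. norm x = 1 \<and> P = ray x"
  then obtain x where x: "norm x = 1" "P = ray x" by blast
  have "Q = 0 \<or> Q = P" if Q: "is_proj Q" "P o\<^sub>L Q o\<^sub>L P = Q" for Q
  proof -
    define r where "r = inner (Q x) x"
    have Q_eq: "Q = r *\<^sub>R ray x"
      using Q ray_sandwich[of Q x] x(2) by (simp add: is_proj_def effect_selfadjoint r_def)
    have "Q (Q x) = Q x"
      using Q unfolding is_proj_def by (metis blinfun_apply_blinfun_compose)
    then have "(r * r) *\<^sub>R x = r *\<^sub>R x"
      by (simp add: Q_eq blinfun.bilinear_simps ray_self x)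
    then have "r = 0 \<or> r = 1"
      using x by auto
    then show ?thesis
      using Q_eq x(2) by auto
  qed
  moreover have "P \<noteq> 0"
    using x ray_self[of x] by auto
  ultimately show "minimal_proj P"
    using x by (simp add: minimal_proj_def is_proj_def effect_ray ray_idem)
qed

section \<open>Multiplicative functions on the unit interval\<close>

text \<open>Additivity comes from scaling: for \<open>s = a + b\<close> and \<open>a = s u\<close> we have \<open>b = s (1 - u)\<close>, so
  \<open>f a + f b = f s (f u + f (1 - u)) = f s\<close>. An additive nonnegative function is monotone, is the
  identity on rationals, and is squeezed between neighbouring fractions elsewhere.\<close>

lemma multiplicative_symmetric_eq_id:
  fixes f :: "real \<Rightarrow> real"
  assumes mult: "\<And>s t. \<lbrakk>0 \<le> s; s \<le> 1; 0 \<le> t; t \<le> 1\<rbrakk> \<Longrightarrow> f (s * t) = f s * f t"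
    and compl: "\<And>t. \<lbrakk>0 \<le> t; t \<le> 1\<rbrakk> \<Longrightarrow> f (1 - t) = 1 - f t"
    and nonneg: "\<And>t. \<lbrakk>0 \<le> t; t \<le> 1\<rbrakk> \<Longrightarrow> 0 \<le> f t"
    and one: "f 1 = 1"
    and t: "0 \<le> t" "t \<le> 1"
  shows "f t = t"
proof -
  have zero: "f 0 = 0"
    using compl[of 1] one by simp
  have add: "f (a + b) = f a + f b" if "0 \<le> a" "0 \<le> b" "a + b \<le> 1" for a b
  proof (cases "a + b = 0")
    case True
    then have "a = 0" "b = 0" using that by linarith+
    then show ?thesis using zero by simp
  next
    case False
    define s where "s = a + b"
    define u where "u = a / s"
    have s: "0 < s" "s \<le> 1" "a \<le> s"
      using that False by (simp_all add: s_def)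
    have u: "0 \<le> u" "u \<le> 1"
      using s that(1) by (simp_all add: u_def)
    have "s * u = a"
      using s by (simp add: u_def)
    then have "s * (1 - u) = b"
      by (simp add: s_def right_diff_distrib)
    have "f a + f b = f s * f u + f s * f (1 - u)"
      using mult[of s u] mult[of s "1 - u"] s u \<open>s * u = a\<close> \<open>s * (1 - u) = b\<close> by simp
    also have "\<dots> = f s"
      using compl[OF u] by (simp add: right_diff_distrib)
    finally show ?thesis by (simp add: s_def)
  qed
  have mono: "f a \<le> f b" if "0 \<le> a" "a \<le> b" "b \<le> 1" for a b
    using add[of a "b - a"] nonneg[of "b - a"] that by simp
  have grid: "f (real k / real n) = real k / real n" if "k \<le> n" "0 < n" for k n
  proof -
    have step: "j \<le> n \<Longrightarrow> f (real j / real n) = real j * f (1 / real n)" for j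
    proof (induction j)
      case (Suc j)
      have "f (real j / real n + 1 / real n) = f (real j / real n) + f (1 / real n)"
        using Suc.prems that(2) by (intro add) (auto simp: field_simps)
      then show ?case
        using Suc by (simp add: add_divide_distrib algebra_simps)
    qed (simp add: zero)
    have "f (1 / real n) = 1 / real n"
      using step[of n] that(2) one by (simp add: field_simps)
    then show ?thesis
      using step[OF that(1)] by simp
  qed
  have close: "\<bar>f t - t\<bar> \<le> 1 / real n" if "0 < n" for n
  proof (cases "t = 1")
    case False
    (* t lies in the grid cell from k/n to (k+1)/n, which stays within the unit interval as t < 1 *)
    define k where "k = nat \<lfloor>real n * t\<rfloor>"
    have k: "real k \<le> real n * t" "real n * t < real k + 1"
      using t by (simp_all add: k_def)
    have "real n * t < real n"
      using t False that by simp
    then have "k < n"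
      using k by linarith
    have "real k / real n \<le> t" "t \<le> real (Suc k) / real n"
      using k that by (simp_all add: field_simps)
    moreover have "f (real k / real n) \<le> f t" "f t \<le> f (real (Suc k) / real n)"
      using calculation t \<open>k < n\<close> by (auto intro!: mono)
    moreover have "real (Suc k) / real n = real k / real n + 1 / real n"
      by (simp add: add_divide_distrib)
    ultimately show ?thesis
      using grid[of k n] grid[of "Suc k" n] \<open>k < n\<close> by auto
  qed (simp add: one)
  show ?thesis
  proof (rule ccontr)
    assume "f t \<noteq> t"
    then obtain n where "inverse (real (Suc n)) < \<bar>f t - t\<bar>"
      using reals_Archimedean[of "\<bar>f t - t\<bar>"] by auto
    then show False
      using close[of "Suc n"] by (simp add: inverse_eq_divide)
  qed
qed

section \<open>Transition probabilities in dimension at least two\<close>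

lemma exists_orthogonal_unit:
  fixes x :: "'a::complex_inner"
  assumes dim: "\<exists>S :: 'a set. card S = 2 \<and> complex_vector.independent S"
    and x: "norm x = 1"
  shows "\<exists>z. norm z = 1 \<and> cinner z x = 0"
proof -
  obtain a b :: 'a where ab: "a \<noteq> b" "complex_vector.independent {a, b}"
    using dim by (auto simp: card_2_iff)
  have "\<exists>y. y \<noteq> cinner y x *\<^sub>C x"
  proof (rule ccontr)
    assume "\<not> ?thesis"
    then have multiple: "y = cinner y x *\<^sub>C x" for y by blast
    have "a \<noteq> 0"
      using ab complex_vector.dependent_zero[of "{a, b}"] by auto
    then have "cinner a x \<noteq> 0"
      using multiple[of a] by auto
    then have "b = (cinner b x / cinner a x) *\<^sub>C a"
      using multiple[of b] by (subst multiple[of a]) (simp add: scaleC_scaleC)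
    then have "b \<in> complex_vector.span {a}"
      by (metis complex_vector.span_base complex_vector.span_scale singletonI)
    moreover have "b \<notin> complex_vector.span {a}"
      using ab complex_vector.independent_insert[of b "{a}"] by (auto simp: insert_commute)
    ultimately show False by blast
  qed
  then obtain y where y: "y - cinner y x *\<^sub>C x \<noteq> 0" by auto
  define w where "w = y - cinner y x *\<^sub>C x"
  have "cinner w x = 0"
    using x by (simp add: w_def cinner_simps cinner_self)
  then show ?thesis
    using y by (intro exI[of _ "(1 / norm w) *\<^sub>R w"]) (simp add: cinner_scaleR_left w_def)
qed

lemma exists_transition_probability:
  fixes x :: "'a::complex_inner"
  assumes dim: "\<exists>S :: 'a set. card S = 2 \<and> complex_vector.independent S"
    and x: "norm x = 1" and t: "0 \<le> t" "t \<le> 1"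
  shows "\<exists>y. norm y = 1 \<and> (cmod (cinner x y))\<^sup>2 = t"
proof -
  obtain z where z: "norm z = 1" "cinner z x = 0"
    using exists_orthogonal_unit[OF dim x] by blast
  then have xz: "cinner x z = 0" using cinner_eq_0_commute by blast
  define y where "y = sqrt t *\<^sub>R x + sqrt (1 - t) *\<^sub>R z"
  have ip: "inner x x = 1" "inner z z = 1" "inner x z = 0" "inner z x = 0"
    using x z xz by (simp_all flip: power2_norm_eq_inner Re_cinner)
  have "(norm y)\<^sup>2 = 1"
    using t by (simp add: y_def power2_norm_eq_inner inner_simps ip)
  then have "norm y = 1" using power2_eq_iff_nonneg[of "norm y" 1] by simp
  moreover have "cinner x y = complex_of_real (sqrt t)"
    using x xz by (simp add: y_def cinner_simps cinner_self)
  ultimately show ?thesis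
    using t by auto
qed

section \<open>Sequential automorphisms\<close>

locale sequential_auto =
  fixes \<phi> :: "('a::complex_hilbert_space \<Rightarrow>\<^sub>L 'a) \<Rightarrow> ('a \<Rightarrow>\<^sub>L 'a)"
  assumes aut: "sequential_automorphism \<phi>"
begin

lemma effect_image: "A \<in> effects \<Longrightarrow> \<phi> A \<in> effects"
  using aut by (auto simp: sequential_automorphism_def bij_betw_def)

lemma inj: "A \<in> effects \<Longrightarrow> B \<in> effects \<Longrightarrow> \<phi> A = \<phi> B \<longleftrightarrow> A = B"
  using aut by (auto simp: sequential_automorphism_def bij_betw_def dest: inj_onD)

lemma onto: "B \<in> effects \<Longrightarrow> \<exists>A\<in>effects. \<phi> A = B"
  using aut unfolding sequential_automorphism_def bij_betw_def by (metis imageE)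

text \<open>Square roots exist, so \<open>B \<circ>\<^sub>s B\<close> is \<open>B\<^sup>2\<close>.\<close>

lemma square:
  assumes A: "A \<in> effects"
  shows "\<phi> (A o\<^sub>L A) = \<phi> A o\<^sub>L \<phi> A"
proof -
  have "B \<circ>\<^sub>s B = B o\<^sub>L B" if B: "B \<in> effects" for B :: "'a \<Rightarrow>\<^sub>L 'a"
  proof -
    obtain R where R: "R \<in> effects" "R o\<^sub>L R = B"
      using effect_has_root[OF B] by blast
    then have "sqrt_op B = R"
      using sqrt_op_square by blast
    then show ?thesis
      unfolding seq_prod_def R(2)[symmetric] by (simp add: blinfun_compose_assoc)
  qed
  then show ?thesis
    using aut A effect_image[OF A] by (metis sequential_automorphism_def)
qed

text \<open>The product \<open>A\<^sup>2 \<circ>\<^sub>s B\<close> is \<open>A B A\<close> because \<open>A\<close> is the root of \<open>A\<^sup>2\<close>, and likewise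
  on the side of the images.\<close>

lemma sandwich:
  assumes A: "A \<in> effects" and B: "B \<in> effects"
  shows "\<phi> (A o\<^sub>L B o\<^sub>L A) = \<phi> A o\<^sub>L \<phi> B o\<^sub>L \<phi> A"
proof -
  have "\<phi> ((A o\<^sub>L A) \<circ>\<^sub>s B) = (\<phi> A o\<^sub>L \<phi> A) \<circ>\<^sub>s \<phi> B"
    using aut effect_square[OF A] B square[OF A] by (simp add: sequential_automorphism_def)
  then show ?thesis
    by (simp add: seq_prod_def sqrt_op_square A effect_image)
qed

text \<open>The effect \<open>Z\<close> that is mapped to 0 satisfies \<open>Z 0 Z = 0\<close>.\<close>

lemma zero: "\<phi> 0 = 0"
proof -
  obtain Z where Z: "Z \<in> effects" "\<phi> Z = 0"
    using onto[OF effect_0] by blast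
  have "Z o\<^sub>L 0 o\<^sub>L Z = 0"
    by (rule blinfun_eqI) simp
  then have "\<phi> 0 = 0 o\<^sub>L \<phi> 0 o\<^sub>L 0"
    using sandwich[OF Z(1) effect_0] Z(2) by simp
  also have "\<dots> = 0"
    by (rule blinfun_eqI) simp
  finally show ?thesis .
qed

lemma eq_0_iff: "A \<in> effects \<Longrightarrow> \<phi> A = 0 \<longleftrightarrow> A = 0"
  using inj[OF _ effect_0, of A] zero by simp

lemma zero_product_iff:
  assumes A: "A \<in> effects" and B: "B \<in> effects"
  shows "\<phi> A o\<^sub>L \<phi> B = 0 \<longleftrightarrow> A o\<^sub>L B = 0"
proof -
  have "\<phi> A o\<^sub>L \<phi> B = 0 \<longleftrightarrow> \<phi> (B o\<^sub>L A o\<^sub>L B) = 0"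
    by (simp add: sandwich A B effect_sandwich_eq_0_iff effect_image)
  also have "\<dots> \<longleftrightarrow> B o\<^sub>L A o\<^sub>L B = 0"
    by (rule eq_0_iff[OF effect_sandwich[OF B A]])
  also have "\<dots> \<longleftrightarrow> A o\<^sub>L B = 0"
    by (rule effect_sandwich_eq_0_iff[OF B A])
  finally show ?thesis .
qed

lemma proj_iff:
  assumes "A \<in> effects"
  shows "is_proj (\<phi> A) \<longleftrightarrow> is_proj A"
  using inj[OF effect_square[OF assms] assms] assms
  by (simp add: is_proj_def effect_image square)

lemma minimal_proj_iff:
  assumes P: "P \<in> effects"
  shows "minimal_proj (\<phi> P) \<longleftrightarrow> minimal_proj P"
proof -
  have dominated: "\<phi> P o\<^sub>L \<phi> Q o\<^sub>L \<phi> P = \<phi> Q \<longleftrightarrow> P o\<^sub>L Q o\<^sub>L P = Q" if "Q \<in> effects" for Q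
    using inj[OF effect_sandwich[OF P that] that] by (simp add: sandwich P that)
  have "(\<forall>Q. is_proj Q \<and> \<phi> P o\<^sub>L Q o\<^sub>L \<phi> P = Q \<longrightarrow> Q = 0 \<or> Q = \<phi> P) \<longleftrightarrow>
      (\<forall>Q. is_proj Q \<and> P o\<^sub>L Q o\<^sub>L P = Q \<longrightarrow> Q = 0 \<or> Q = P)" (is "?l \<longleftrightarrow> ?r")
  proof
    assume l: ?l
    show ?r
    proof (intro allI impI)
      fix Q assume Q: "is_proj Q \<and> P o\<^sub>L Q o\<^sub>L P = Q"
      then have "Q \<in> effects" by (simp add: is_proj_def)
      then have "\<phi> Q = 0 \<or> \<phi> Q = \<phi> P"
        using l Q dominated proj_iff by blast
      then show "Q = 0 \<or> Q = P"
        using \<open>Q \<in> effects\<close> eq_0_iff inj P by blast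
    qed
  next
    assume r: ?r
    show ?l
    proof (intro allI impI)
      fix Q assume Q: "is_proj Q \<and> \<phi> P o\<^sub>L Q o\<^sub>L \<phi> P = Q"
      then obtain Q' where Q': "Q' \<in> effects" "Q = \<phi> Q'"
        using onto by (metis is_proj_def)
      then have "Q' = 0 \<or> Q' = P"
        using r Q dominated proj_iff by blast
      then show "Q = 0 \<or> Q = \<phi> P"
        using Q' zero by blast
    qed
  qed
  then show ?thesis
    by (simp add: minimal_proj_def proj_iff eq_0_iff P)
qed

lemma ray_image:
  assumes "norm x = 1"
  shows "\<exists>y. norm y = 1 \<and> \<phi> (ray x) = ray y"
  using assms minimal_proj_iff[OF effect_ray[OF assms]] minimal_proj_iff_ray by blast

lemma ray_preimage:
  assumes "norm y = 1"
  shows "\<exists>x. norm x = 1 \<and> \<phi> (ray x) = ray y"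
proof -
  obtain P where P: "P \<in> effects" "\<phi> P = ray y"
    using onto[OF effect_ray[OF assms]] by blast
  then have "minimal_proj P"
    using minimal_proj_iff[OF P(1)] minimal_proj_iff_ray assms by metis
  then show ?thesis
    using P minimal_proj_iff_ray by metis
qed

text \<open>Let \<open>P'\<close> and \<open>Q'\<close> be the complements of \<open>P\<close> and of its image. The preimage \<open>S\<close> of \<open>Q'\<close> has zero
  product with \<open>P\<close>, so \<open>P' S P' = S\<close>, whose image reads \<open>R Q' R = Q'\<close> with \<open>R = \<phi>(P')\<close>. On the other hand
  \<open>R\<close> is a projection with zero product with the image of \<open>P\<close>, so \<open>R Q' R = R\<close>.\<close>

lemma complement:
  assumes P: "is_proj P"
  shows "\<phi> (id_blinfun - P) = id_blinfun - \<phi> P"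
proof -
  have Pe: "P \<in> effects" and PP: "P (P x) = P x" for x
    using P by (simp_all add: is_proj_def) (metis blinfun_apply_blinfun_compose)
  have compl_proj: "is_proj (id_blinfun - P)" if P: "is_proj P" for P :: "'a \<Rightarrow>\<^sub>L 'a"
  proof -
    have "P (P x) = P x" for x
      using P by (metis blinfun_apply_blinfun_compose is_proj_def)
    then show ?thesis
      using P by (auto simp: is_proj_def effect_complement blinfun.bilinear_simps intro!: blinfun_eqI)
  qed
  let ?P' = "id_blinfun - P" and ?Q' = "id_blinfun - \<phi> P"
  have Q: "is_proj (\<phi> P)"
    using P Pe by (simp add: proj_iff)
  have P'e: "?P' \<in> effects" and Q'e: "?Q' \<in> effects"
    using Pe Q by (simp_all add: effect_complement is_proj_def)
  obtain S where S: "S \<in> effects" "\<phi> S = ?Q'"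
    using onto[OF Q'e] by blast
  have QQ: "\<phi> P (\<phi> P x) = \<phi> P x" for x
    using Q by (metis blinfun_apply_blinfun_compose is_proj_def)
  have "\<phi> S o\<^sub>L \<phi> P = 0"
    by (rule blinfun_eqI) (simp add: S blinfun.diff_left QQ)
  then have SP: "S o\<^sub>L P = 0"
    using zero_product_iff[OF S(1) Pe] by simp
  have "?P' o\<^sub>L P = 0"
    by (rule blinfun_eqI) (simp add: blinfun.diff_left PP)
  then have RQ: "\<phi> ?P' o\<^sub>L \<phi> P = 0"
    using zero_product_iff[OF P'e Pe] by simp
  have "?P' o\<^sub>L S o\<^sub>L ?P' = S"
  proof -
    have "S (P x) = 0" "P (S x) = 0" for x
      using arg_cong[OF SP, of "\<lambda>f. blinfun_apply f x"]
        arg_cong[OF selfadjoint_compose_eq_0_commute[OF effect_selfadjoint[OF S(1)] effect_selfadjoint[OF Pe] SP],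
          of "\<lambda>f. blinfun_apply f x"]
      by simp_all
    then show ?thesis
      by (intro blinfun_eqI) (simp add: blinfun.bilinear_simps)
  qed
  then have "?Q' = \<phi> ?P' o\<^sub>L ?Q' o\<^sub>L \<phi> ?P'"
    using sandwich[OF P'e S(1)] S(2) by simp
  also have "\<dots> = \<phi> ?P'"
  proof (rule blinfun_eqI)
    fix x
    have "\<phi> ?P' (\<phi> P y) = 0" for y
      using arg_cong[OF RQ, of "\<lambda>f. blinfun_apply f y"] by simp
    moreover have "is_proj (\<phi> ?P')"
      using compl_proj[OF P] P'e by (simp add: proj_iff)
    then have "\<phi> ?P' (\<phi> ?P' x) = \<phi> ?P' x"
      by (metis blinfun_apply_blinfun_compose is_proj_def)
    ultimately show "(\<phi> ?P' o\<^sub>L ?Q' o\<^sub>L \<phi> ?P') x = \<phi> ?P' x"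
      by (simp add: blinfun.diff_left blinfun.diff_right)
  qed
  finally show ?thesis by simp
qed

text \<open>The function \<open>f\<close> in the proof is determined by \<open>\<phi>(t P\<^sub>x) = f(t) P\<^sub>y\<close>. Triple products give
  \<open>f(s\<^sup>2 t) = f(s)\<^sup>2 f(t)\<close>, which with \<open>f 1 = 1\<close> is multiplicativity. The symmetry of \<open>f\<close> about 1/2 comes from
  applying \<open>factor\<close> to a rank-one projection and to its complement.\<close>

lemma expectation_preserved:
  assumes dim: "\<exists>S :: 'a set. card S = 2 \<and> complex_vector.independent S"
    and x: "norm x = 1" and y: "norm y = 1" and ray: "\<phi> (ray x) = ray y"
    and A: "A \<in> effects"
  shows "inner (\<phi> A y) y = inner (A x) x"
proof -
  define f where "f t = inner (\<phi> (t *\<^sub>R ray x) y) y" for t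
  have factor: "f (inner (B x) x) = inner (\<phi> B y) y" if B: "B \<in> effects" for B
  proof -
    have "\<phi> (inner (B x) x *\<^sub>R ray x) = ray y o\<^sub>L \<phi> B o\<^sub>L ray y"
      using sandwich[OF effect_ray[OF x] B]
      by (simp add: ray ray_sandwich effect_selfadjoint[OF B])
    also have "\<dots> = inner (\<phi> B y) y *\<^sub>R ray y"
      by (rule ray_sandwich[OF effect_selfadjoint[OF effect_image[OF B]]])
    finally show ?thesis
      using y by (simp add: f_def blinfun.scaleR_left ray_self flip: power2_norm_eq_inner)
  qed
  have scaled: "t *\<^sub>R ray x \<in> effects" if "0 \<le> t" "t \<le> 1" for t
    unfolding effects_iff
  proof (intro conjI allI)
    show "selfadjoint (t *\<^sub>R ray x)" by (intro selfadjoint_scaleR selfadjoint_ray)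
    fix z
    show "0 \<le> inner ((t *\<^sub>R ray x) z) z"
      using that by (simp add: blinfun.scaleR_left inner_ray)
    have "t * inner (ray x z) z \<le> 1 * (norm z)\<^sup>2"
      using that effect_le[OF effect_ray[OF x]] by (intro mult_mono) (auto simp: inner_ray)
    then show "inner ((t *\<^sub>R ray x) z) z \<le> (norm z)\<^sup>2"
      by (simp add: blinfun.scaleR_left)
  qed
  have image: "\<phi> (t *\<^sub>R ray x) = f t *\<^sub>R ray y" if "0 \<le> t" "t \<le> 1" for t
  proof -
    have "inner ((t *\<^sub>R ray x) x) x = t"
      using x by (simp add: blinfun.scaleR_left ray_self flip: power2_norm_eq_inner)
    then have "ray x o\<^sub>L (t *\<^sub>R ray x) o\<^sub>L ray x = t *\<^sub>R ray x"
      by (simp only: ray_sandwich[OF effect_selfadjoint[OF scaled[OF that]]])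
    then have "\<phi> (t *\<^sub>R ray x) = ray y o\<^sub>L \<phi> (t *\<^sub>R ray x) o\<^sub>L ray y"
      using sandwich[OF effect_ray[OF x] scaled[OF that]] by (simp only: ray)
    also have "\<dots> = f t *\<^sub>R ray y"
      unfolding f_def by (rule ray_sandwich[OF effect_selfadjoint[OF effect_image[OF scaled[OF that]]]])
    finally show ?thesis .
  qed
  have one: "f 1 = 1"
    using y by (simp add: f_def ray ray_self flip: power2_norm_eq_inner)
  have mult': "f (s * s * t) = f s * f s * f t" if "0 \<le> s" "s \<le> 1" "0 \<le> t" "t \<le> 1" for s t
  proof -
    have rr: "ray x (ray x z) = ray x z" "ray y (ray y z) = ray y z" for z
      using ray_idem[OF x] ray_idem[OF y] by (metis blinfun_apply_blinfun_compose)+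
    have "(s *\<^sub>R ray x) o\<^sub>L (t *\<^sub>R ray x) o\<^sub>L (s *\<^sub>R ray x) = (s * s * t) *\<^sub>R ray x"
      by (rule blinfun_eqI) (simp add: blinfun.bilinear_simps rr mult_ac)
    moreover have "(f s *\<^sub>R ray y) o\<^sub>L (f t *\<^sub>R ray y) o\<^sub>L (f s *\<^sub>R ray y) = (f s * f s * f t) *\<^sub>R ray y"
      by (rule blinfun_eqI) (simp add: blinfun.bilinear_simps rr mult_ac)
    ultimately have "\<phi> ((s * s * t) *\<^sub>R ray x) = (f s * f s * f t) *\<^sub>R ray y"
      using sandwich[OF scaled[of s] scaled[of t]] that by (simp add: image)
    then show ?thesis
      using y by (simp add: f_def[of "s * s * t"] blinfun.scaleR_left ray_self flip: power2_norm_eq_inner)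
  qed
  have mult: "f (s * t) = f s * f t" if "0 \<le> s" "s \<le> 1" "0 \<le> t" "t \<le> 1" for s t
    using mult'[of "sqrt s" t] mult'[of "sqrt s" 1] that by (simp add: one)
  have compl: "f (1 - t) = 1 - f t" if t: "0 \<le> t" "t \<le> 1" for t
  proof -
    obtain z where z: "norm z = 1" "(cmod (cinner x z))\<^sup>2 = t"
      using exists_transition_probability[OF dim x t] by blast
    have x_t: "inner (ray z x) x = t"
      using z by (simp add: inner_ray)
    have proj: "is_proj (ray z)"
      using z by (simp add: is_proj_def effect_ray ray_idem)
    have "f (1 - t) = inner (\<phi> (id_blinfun - ray z) y) y"
      using factor[OF effect_complement[OF effect_ray[OF z(1)]]] x
      by (simp add: blinfun.diff_left inner_diff_left x_t flip: power2_norm_eq_inner)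
    also have "\<dots> = 1 - inner (\<phi> (ray z) y) y"
      using y by (simp add: complement[OF proj] blinfun.diff_left inner_diff_left flip: power2_norm_eq_inner)
    also have "\<dots> = 1 - f t"
      using factor[OF effect_ray[OF z(1)]] by (simp add: x_t)
    finally show ?thesis .
  qed
  have nonneg: "0 \<le> f t" if "0 \<le> t" "t \<le> 1" for t
    unfolding f_def by (rule effect_nonneg[OF effect_image[OF scaled[OF that]]])
  have "f (inner (A x) x) = inner (A x) x"
    using multiplicative_symmetric_eq_id[of f "inner (A x) x"] mult compl nonneg one
      effect_nonneg[OF A, of x] effect_le[OF A, of x] x by simp
  then show ?thesis
    using factor[OF A] by simp
qed

text \<open>The map on lines induced by \<open>\<phi>\<close> is extended to all vectors by homogeneity in the norm, and
  expectations of rank-one projections are transition probabilities, so Wigner's theorem applies. The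
  phase between \<open>T x\<close> and \<open>U x\<close> cancels in quadratic forms.\<close>

lemma implemented:
  assumes dim: "\<exists>S :: 'a set. card S = 2 \<and> complex_vector.independent S"
  shows "\<exists>U. (unitary U \<or> antiunitary U) \<and> (\<forall>A\<in>effects. \<forall>x. inner (\<phi> A (U x)) (U x) = inner (A x) x)"
proof -
  obtain \<tau> where \<tau>: "norm x = 1 \<Longrightarrow> norm (\<tau> x) = 1 \<and> \<phi> (ray x) = ray (\<tau> x)" for x
    using ray_image by metis
  define unit where "unit x = (1 / norm x) *\<^sub>R x" for x :: 'a
  have unit: "norm (unit x) = 1" "norm x *\<^sub>R unit x = x" if "x \<noteq> 0" for x
    using that by (simp_all add: unit_def)
  define T where "T x = norm x *\<^sub>R \<tau> (unit x)" for x
  have \<tau>_mod: "cmod (cinner (\<tau> x) (\<tau> y)) = cmod (cinner x y)" if "norm x = 1" "norm y = 1" for x y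
  proof -
    have "(cmod (cinner (\<tau> x) (\<tau> y)))\<^sup>2 = (cmod (cinner x y))\<^sup>2"
      using expectation_preserved[OF dim that(1), of "\<tau> x" "ray y"] \<tau>[OF that(1)] \<tau>[OF that(2)] that
      by (simp add: effect_ray inner_ray)
    then show ?thesis by simp
  qed
  have "cmod (cinner (T x) (T y)) = cmod (cinner x y)" for x y
  proof (cases "x = 0 \<or> y = 0")
    case True
    then show ?thesis by (auto simp: T_def)
  next
    case False
    then have "cmod (cinner (T x) (T y)) = norm x * norm y * cmod (cinner (unit x) (unit y))"
      by (simp add: T_def cinner_scaleR_left cinner_scaleR_right norm_mult \<tau>_mod unit(1))
    also have "\<dots> = cmod (cinner (norm x *\<^sub>R unit x) (norm y *\<^sub>R unit y))"
      by (simp only: cinner_scaleR_left cinner_scaleR_right norm_mult) simp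
    finally show ?thesis using False unit(2)[of x] unit(2)[of y] by simp
  qed
  moreover have "\<exists>x c. cmod c = 1 \<and> T x = c *\<^sub>C y" for y
  proof (cases "y = 0")
    case True
    then show ?thesis by (intro exI[of _ 0] exI[of _ 1]) (simp add: T_def)
  next
    case False
    obtain u where u: "norm u = 1" "\<phi> (ray u) = ray (unit y)"
      using ray_preimage unit(1)[OF False] by blast
    then obtain c where c: "cmod c = 1" "\<tau> u = c *\<^sub>C unit y"
      using ray_eq_parallel[of "\<tau> u" "unit y"] \<tau>[OF u(1)] unit(1)[OF False] by auto
    have "unit (norm y *\<^sub>R u) = u"
      using False u by (simp add: unit_def)
    then have "T (norm y *\<^sub>R u) = norm y *\<^sub>R (c *\<^sub>C unit y)"
      using u by (simp add: T_def c)
    also have "\<dots> = c *\<^sub>C (norm y *\<^sub>R unit y)"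
      by (simp only: scaleR_scaleC scaleC_scaleC mult.commute)
    also have "\<dots> = c *\<^sub>C y"
      by (simp only: unit(2)[OF False])
    finally show ?thesis using c by blast
  qed
  ultimately obtain U where U: "unitary U \<or> antiunitary U"
    and T_U: "\<And>x. \<exists>c. cmod c = 1 \<and> T x = c *\<^sub>C U x"
    using wigner[of T] by blast
  have "inner (\<phi> A (U x)) (U x) = inner (A x) x" if A: "A \<in> effects" for A x
  proof -
    obtain c where c: "cmod c = 1" "T x = c *\<^sub>C U x"
      using T_U by blast
    have "cnj c * c = 1"
      using c(1) by (simp add: mult.commute complex_norm_square[symmetric])
    then have "cinner (\<phi> A (T x)) (T x) = cinner (\<phi> A (U x)) (U x)"
      by (simp add: c(2) selfadjoint_scaleC[OF effect_selfadjoint[OF effect_image[OF A]]]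
          cinner_scaleC_left cinner_scaleC_right flip: mult.assoc)
    then have "inner (\<phi> A (U x)) (U x) = inner (\<phi> A (T x)) (T x)"
      by (simp flip: Re_cinner)
    also have "\<dots> = inner (A x) x"
    proof (cases "x = 0")
      case False
      have "inner (\<phi> A (T x)) (T x) = (norm x)\<^sup>2 * inner (A (unit x)) (unit x)"
        using expectation_preserved[OF dim unit(1)[OF False] _ _ A] \<tau>[OF unit(1)[OF False]]
        by (simp add: T_def blinfun.scaleR_right power2_eq_square)
      also have "\<dots> = inner (A (norm x *\<^sub>R unit x)) (norm x *\<^sub>R unit x)"
        by (simp add: blinfun.scaleR_right power2_eq_square)
      finally show ?thesis
        by (simp only: unit(2)[OF False])
    qed (simp add: T_def)
    finally show ?thesis .
  qed
  then show ?thesis using U by blast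
qed

end

section \<open>Implementation by a unitary or antiunitary operator\<close>

lemma isometry_real_linear:
  assumes "unitary U \<or> antiunitary U"
  shows "surj U" "U (x + y) = U x + U y" "inner (U x) (U y) = inner x y" "adjoint U (U x) = x"
proof -
  show "surj U" "U (x + y) = U x + U y"
    using assms by (auto simp: unitary_def antiunitary_def antilinear_def Vector_Spaces.linear_iff)
  show ip: "inner (U x) (U y) = inner x y" for x y
    using assms by (auto simp: unitary_def antiunitary_def simp flip: Re_cinner)
  have "inner (adjoint U (U x)) z = inner x z" for z
  proof -
    have "Re (cinner (U z) (U x)) = Re (cinner z (adjoint U (U x)))"
      using assms cinner_adjoint_unitary cinner_adjoint_antiunitary by fastforce
    then show ?thesis
      by (simp add: Re_cinner ip inner_commute)
  qed
  then show "adjoint U (U x) = x"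
    by (metis vector_eq_rdot)
qed

text \<open>Polarization over the reals suffices, so the unitary and the antiunitary case need no distinction.\<close>

lemma quadratic_form_determines:
  fixes A B :: "'a::complex_inner \<Rightarrow>\<^sub>L 'a"
  assumes U: "unitary U \<or> antiunitary U"
    and A: "selfadjoint A" and B: "selfadjoint B"
    and quad: "\<And>x. inner (B (U x)) (U x) = inner (A x) x"
  shows "blinfun_apply B = U \<circ> blinfun_apply A \<circ> adjoint U"
proof
  note U_simps = isometry_real_linear[OF U]
  have BU: "B (U x) = U (A x)" for x
  proof -
    have "inner (B (U x)) (U y) = inner (A x) y" for y
    proof -
      have "inner (B (U x)) (U y) + inner (B (U y)) (U x) = inner (A x) y + inner (A y) x"
        using quad[of "x + y"] quad[of x] quad[of y]
        by (simp add: U_simps(2) blinfun.add_right inner_add_left inner_add_right)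
      moreover have "inner (B (U y)) (U x) = inner (B (U x)) (U y)" "inner (A y) x = inner (A x) y"
        using selfadjoint_inner[OF B, of "U y" "U x"] selfadjoint_inner[OF A, of y x]
      by (simp_all only: inner_commute)
      ultimately show ?thesis by simp
    qed
    then have "inner (B (U x)) (U y) = inner (U (A x)) (U y)" for y
      by (simp add: U_simps(3))
    then show ?thesis
      using U_simps(1) by (metis surj_def vector_eq_rdot)
  qed
  fix y
  obtain x where "y = U x" using U_simps(1) by (metis surj_def)
  then show "B y = (U \<circ> blinfun_apply A \<circ> adjoint U) y"
    by (simp add: BU U_simps(4))
qed

theorem corollary7:
  fixes \<phi> :: "('a::complex_hilbert_space \<Rightarrow>\<^sub>L 'a) \<Rightarrow> ('a \<Rightarrow>\<^sub>L 'a)"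
  assumes dim: "\<exists>S :: 'a set. card S = 2 \<and> complex_vector.independent S"
    and aut: "sequential_automorphism \<phi>"
  shows "(\<forall>A\<in>effects. \<forall>B\<in>effects. A \<preceq> B \<longleftrightarrow> \<phi> A \<preceq> \<phi> B) \<and>
    (\<forall>A\<in>effects. \<forall>B\<in>effects. A o\<^sub>L B = 0 \<longleftrightarrow> \<phi> A o\<^sub>L \<phi> B = 0) \<and>
    (\<exists>U :: 'a \<Rightarrow> 'a. (unitary U \<or> antiunitary U) \<and>
      (\<forall>A\<in>effects. blinfun_apply (\<phi> A) = U \<circ> blinfun_apply A \<circ> adjoint U))"
proof -
  interpret sequential_auto \<phi> by unfold_locales (rule aut)
  obtain U where U: "unitary U \<or> antiunitary U"
    and quad: "\<And>A x. A \<in> effects \<Longrightarrow> inner (\<phi> A (U x)) (U x) = inner (A x) x"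
    using implemented[OF dim] by blast
  have "A \<preceq> B \<longleftrightarrow> \<phi> A \<preceq> \<phi> B" if "A \<in> effects" "B \<in> effects" for A B
  proof -
    have "(\<forall>y. inner (\<phi> A y) y \<le> inner (\<phi> B y) y) \<longleftrightarrow>
        (\<forall>x. inner (\<phi> A (U x)) (U x) \<le> inner (\<phi> B (U x)) (U x))"
      using isometry_real_linear(1)[OF U] by (metis surj_def)
    then show ?thesis
      using that by (simp add: op_le_def effect_selfadjoint effect_image Re_cinner quad)
  qed
  moreover have "blinfun_apply (\<phi> A) = U \<circ> blinfun_apply A \<circ> adjoint U" if "A \<in> effects" for A
    by (rule quadratic_form_determines[OF U]) (use that in \<open>auto simp: effect_selfadjoint effect_image quad\<close>)
  ultimately show ?thesis
    using U zero_product_iff by blast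
qed

end
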